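(* There is no algorithm that, given a switching system with equality guards, computes its strongest algebraic inductive invariant.
   Context: A switching system with equality guards (in dimension $d$) is a linear hybrid automaton with finitely many locations $Q$, where each location $q$ has linear continuous dynamics $x'=A_qx$ (with $A_q$ a real $d\times d$ matrix with algebraic entries), each location has an algebraic set $T_q\subseteq\mathbb{R}^d$ of initial states, and finitely many discrete edges between locations which do not update the variables but may carry a guard given by polynomial equalities; an edge from $p$ to $q$ with guard $G$ (an algebraic set) can be taken from state $x$ in $p$ only if $x\in G$, leading to state $x$ in $q$. An algebraic inductive invariant is a family $(V_q)_{q\in Q}$ of real algebraic sets with $T_q\subseteq V_q$, $e^{A_qt}V_q\subseteq V_q$ for all $t\ge0$, and $V_p\cap G\subseteq V_q$ for every edge from $p$ to $q$ with guard $G$. The strongest algebraic inductive invariant is the location-wise intersection of all algebraic inductive invariants (itself an algebraic inductive invariant); computing it means outputting finitely many polynomials defining each $V_q$. *)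

theory Defs
  imports
    Complex_Main
    "HOL-Library.Nat_Bijection"
    "HOL-Library.Poly_Mapping"
    "HOL-Computational_Algebra.Polynomial"
    "Jordan_Normal_Form.Matrix"
begin

section \<open>Real algebraic sets\<close>

text \<open>Polynomials in the variables \<open>x\<^sub>0, x\<^sub>1, \<dots>\<close>: a monomial maps a variable to its exponent, and a
  polynomial maps a monomial to its coefficient.\<close>

type_synonym 'a mpoly = "(nat \<Rightarrow>\<^sub>0 nat) \<Rightarrow>\<^sub>0 'a"

definition mpoly_vars :: "'a::zero mpoly \<Rightarrow> nat set" where
  "mpoly_vars p = (\<Union>m\<in>Poly_Mapping.keys p. Poly_Mapping.keys m)"

definition mpoly_eval :: "real mpoly \<Rightarrow> real vec \<Rightarrow> real" where
  "mpoly_eval p x =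
     (\<Sum>m\<in>Poly_Mapping.keys p. Poly_Mapping.lookup p m *
        (\<Prod>i\<in>Poly_Mapping.keys m. (x $ i) ^ Poly_Mapping.lookup m i))"

definition zero_set :: "nat \<Rightarrow> real mpoly set \<Rightarrow> real vec set" where
  "zero_set d ps = {x \<in> carrier_vec d. \<forall>p\<in>ps. mpoly_eval p x = 0}"

definition algebraic_set :: "nat \<Rightarrow> real vec set \<Rightarrow> bool" where
  "algebraic_set d V \<longleftrightarrow>
     (\<exists>ps. finite ps \<and> (\<forall>p\<in>ps. mpoly_vars p \<subseteq> {..<d}) \<and> V = zero_set d ps)"


section \<open>Switching systems with equality guards\<close>

record switching_system =
  dim :: nat
  locs :: "nat set"
  dyn :: "nat \<Rightarrow> real mat"
  start :: "nat \<Rightarrow> real vec set"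
  edges :: "(nat \<times> real vec set \<times> nat) set"

text \<open>An unguarded edge is one whose guard is the whole space, the zero set of no polynomial.\<close>

definition switching_system_eq_guards :: "switching_system \<Rightarrow> bool" where
  "switching_system_eq_guards S \<longleftrightarrow>
     finite (locs S) \<and>
     (\<forall>q\<in>locs S. dyn S q \<in> carrier_mat (dim S) (dim S) \<and>
        (\<forall>i<dim S. \<forall>j<dim S. algebraic (dyn S q $$ (i, j))) \<and>
        algebraic_set (dim S) (start S q)) \<and>
     finite (edges S) \<and>
     (\<forall>(p, G, q)\<in>edges S. p \<in> locs S \<and> q \<in> locs S \<and> algebraic_set (dim S) G)"

text \<open>The entrywise sum of the exponential series of a square matrix; each of these series converges
  absolutely.\<close>

definition mat_exp :: "real mat \<Rightarrow> real mat" where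
  "mat_exp A = mat (dim_row A) (dim_row A) 
     (\<lambda>(i, j). suminf (\<lambda>k. (A ^\<^sub>m k) $$ (i, j) / fact k))"

definition algebraic_inductive_invariant ::
    "switching_system \<Rightarrow> (nat \<Rightarrow> real vec set) \<Rightarrow> bool" where
  "algebraic_inductive_invariant S V \<longleftrightarrow>
     (\<forall>q\<in>locs S. algebraic_set (dim S) (V q)) \<and>
     (\<forall>q\<in>locs S. start S q \<subseteq> V q) \<and>
     (\<forall>q\<in>locs S. \<forall>t\<ge>0. (\<lambda>x. mat_exp (t \<cdot>\<^sub>m dyn S q) *\<^sub>v x) ` V q \<subseteq> V q) \<and>
     (\<forall>(p, G, q)\<in>edges S. V p \<inter> G \<subseteq> V q)"

definition strongest_invariant :: "switching_system \<Rightarrow> nat \<Rightarrow> real vec set" where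
  "strongest_invariant S q = \<Inter>{V q | V. algebraic_inductive_invariant S V}"


section \<open>Partial recursive functions\<close>

datatype recf =
    Zero
  | Succ
  | Proj nat
  | Comp recf "recf list"
  | PrimRec recf recf
  | Minim recf

text \<open>\<open>rec_eval f xs y\<close> means that \<open>f\<close> is defined on the argument tuple \<open>xs\<close> and has value \<open>y\<close>
  there. Recursion and minimisation are on the first argument.\<close>

inductive rec_eval :: "recf \<Rightarrow> nat list \<Rightarrow> nat \<Rightarrow> bool" where
  Zero: "rec_eval Zero xs 0"
| Succ: "rec_eval Succ [x] (Suc x)"
| Proj: "i < length xs \<Longrightarrow> rec_eval (Proj i) xs (xs ! i)"
| Comp: "list_all2 (\<lambda>g y. rec_eval g xs y) gs ys \<Longrightarrow> rec_eval f ys z \<Longrightarrow>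
    rec_eval (Comp f gs) xs z"
| PrimRec_0: "rec_eval f xs y \<Longrightarrow> rec_eval (PrimRec f g) (0 # xs) y"
| PrimRec_Suc: "rec_eval (PrimRec f g) (n # xs) y \<Longrightarrow> rec_eval g (n # y # xs) z \<Longrightarrow>
    rec_eval (PrimRec f g) (Suc n # xs) z"
| Minim: "rec_eval f (n # xs) 0 \<Longrightarrow> (\<And>m. m < n \<Longrightarrow> \<exists>y>0. rec_eval f (m # xs) y) \<Longrightarrow>
    rec_eval (Minim f) xs n"

inductive_cases rec_eval_ZeroE: "rec_eval Zero xs z"
inductive_cases rec_eval_SuccE: "rec_eval Succ xs z"
inductive_cases rec_eval_ProjE: "rec_eval (Proj i) xs z"
inductive_cases rec_eval_CompE: "rec_eval (Comp f gs) xs z"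
inductive_cases rec_eval_PrimRec_0E: "rec_eval (PrimRec f g) (0 # xs) z"
inductive_cases rec_eval_PrimRec_SucE: "rec_eval (PrimRec f g) (Suc n # xs) z"
inductive_cases rec_eval_MinimE: "rec_eval (Minim f) xs z"

lemma rec_eval_deterministic: "rec_eval f xs y \<Longrightarrow> rec_eval f xs z \<Longrightarrow> y = z"
proof (induction arbitrary: z rule: rec_eval.induct)
  case (Comp xs gs ys f y)
  from Comp.prems obtain zs where zs: "list_all2 (\<lambda>g y. rec_eval g xs y) gs zs" "rec_eval f zs z"
    by (rule rec_eval_CompE)
  have "ys = zs"
    using Comp.IH(1) zs(1) by (auto simp: list_all2_conv_all_nth intro: nth_equalityI)
  then show ?case using Comp.IH(2) zs(2) by simp
next
  case (Minim f n xs)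
  from Minim.prems have z: "rec_eval f (z # xs) 0" "\<And>m. m < z \<Longrightarrow> \<exists>y>0. rec_eval f (m # xs) y"
    by (auto elim: rec_eval_MinimE)
  show ?case
  proof (cases n z rule: linorder_cases)
    case less
    then show ?thesis using z(2) Minim.IH(1) by fastforce
  next
    case greater
    then show ?thesis using z(1) Minim.IH(2) by fastforce
  qed
qed (blast elim: rec_eval_ZeroE rec_eval_SuccE rec_eval_ProjE rec_eval_PrimRec_0E
      rec_eval_PrimRec_SucE)+


section \<open>Finite representations\<close>

text \<open>A real algebraic number is given by an integer polynomial and a rational open interval in which
  it is the only root of that polynomial.\<close>

type_synonym alg_code = "int poly \<times> rat \<times> rat"

definition isolates :: "alg_code \<Rightarrow> real \<Rightarrow> bool" where
  "isolates c x \<longleftrightarrow> (case c of (p, a, b) \<Rightarrow>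
     of_rat a < x \<and> x < of_rat b \<and> poly (map_poly of_int p) x = 0)"

definition valid_alg :: "alg_code \<Rightarrow> bool" where
  "valid_alg c \<longleftrightarrow> (\<exists>!x. isolates c x)"

definition alg_val :: "alg_code \<Rightarrow> real" where
  "alg_val c = (THE x. isolates c x)"

text \<open>Polynomials in \<open>d\<close> variables are given sparsely, as lists of nonzero coefficients with pairwise
  distinct exponent vectors of length \<open>d\<close>.\<close>

type_synonym mpoly_code = "(alg_code \<times> nat list) list"

definition valid_mpoly :: "nat \<Rightarrow> mpoly_code \<Rightarrow> bool" where
  "valid_mpoly d ts \<longleftrightarrow>
     distinct (map snd ts) \<and>
     (\<forall>(c, es)\<in>set ts. valid_alg c \<and> alg_val c \<noteq> 0 \<and> length es = d)"

definition mpoly_of :: "mpoly_code \<Rightarrow> real mpoly" where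
  "mpoly_of ts = (\<Sum>(c, es)\<leftarrow>ts. Poly_Mapping.single (Poly_Mapping.nth es) (alg_val c))"

text \<open>An algebraic set is given by a list of defining polynomials.\<close>

type_synonym set_code = "mpoly_code list"

definition valid_set :: "nat \<Rightarrow> set_code \<Rightarrow> bool" where
  "valid_set d ps \<longleftrightarrow> (\<forall>p\<in>set ps. valid_mpoly d p)"

definition set_of :: "nat \<Rightarrow> set_code \<Rightarrow> real vec set" where
  "set_of d ps = zero_set d (mpoly_of ` set ps)"

text \<open>A switching system with locations \<open>0, \<dots>, n - 1\<close> is given by its dimension, the list of its
  \<open>n\<close> locations (the rows of the matrix and the initial set), and the list of its edges.\<close>

type_synonym system_code =
  "nat \<times> (alg_code list list \<times> set_code) list \<times> (nat \<times> set_code \<times> nat) list"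

definition valid_system :: "system_code \<Rightarrow> bool" where
  "valid_system C \<longleftrightarrow> (case C of (d, ls, es) \<Rightarrow>
     (\<forall>(rows, T)\<in>set ls. length rows = d \<and>
        (\<forall>row\<in>set rows. length row = d \<and> (\<forall>c\<in>set row. valid_alg c)) \<and> valid_set d T) \<and>
     (\<forall>(p, G, q)\<in>set es. p < length ls \<and> q < length ls \<and> valid_set d G))"

definition system_of :: "system_code \<Rightarrow> switching_system" where
  "system_of C = (case C of (d, ls, es) \<Rightarrow>
     \<lparr> dim = d,
       locs = {..<length ls},
       dyn = (\<lambda>q. mat_of_rows_list d (map (map alg_val) (fst (ls ! q)))),
       start = (\<lambda>q. set_of d (snd (ls ! q))),
       edges = (\<lambda>(p, G, q). (p, set_of d G, q)) ` set es \<rparr>)"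

definition represents_system :: "system_code \<Rightarrow> switching_system \<Rightarrow> bool" where
  "represents_system C S \<longleftrightarrow> valid_system C \<and> S = system_of C"

definition represents_family ::
    "switching_system \<Rightarrow> set_code list \<Rightarrow> (nat \<Rightarrow> real vec set) \<Rightarrow> bool" where
  "represents_family S W V \<longleftrightarrow>
     locs S = {..<length W} \<and>
     (\<forall>q\<in>locs S. valid_set (dim S) (W ! q) \<and> V q = set_of (dim S) (W ! q))"


lemma valid_alg_algebraic:
  assumes "valid_alg c"
  shows "algebraic (alg_val c)"
proof -
  obtain p a b where c: "c = (p, a, b)" by (cases c)
  have ex1: "\<exists>!x. isolates c x" using assms by (simp add: valid_alg_def)
  have val: "isolates c (alg_val c)" unfolding alg_val_def by (rule theI'[OF ex1])
  have "p \<noteq> 0"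
  proof
    assume "p = 0"
    then have all: "isolates c x" if "of_rat a < x" "x < of_rat b" for x
      using that by (simp add: isolates_def c)
    have less: "of_rat a < alg_val c" "alg_val c < of_rat b"
      using val by (auto simp: isolates_def c)
    obtain y where y: "of_rat a < y" "y < alg_val c" using dense[OF less(1)] by blast
    then have "isolates c y" using less by (intro all) auto
    then show False using ex1 val y by blast
  qed
  moreover have "coeff (map_poly of_int p :: real poly) i \<in> \<int>" for i
    by (simp add: coeff_map_poly)
  ultimately show ?thesis
    using val by (intro algebraicI[of "map_poly of_int p"])
      (auto simp: isolates_def c map_poly_eq_0_iff)
qed

lemma mpoly_of_Nil [simp]: "mpoly_of [] = 0"
  by (simp add: mpoly_of_def)

lemma mpoly_of_Cons [simp]:
  "mpoly_of ((c, es) # ts) =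
     Poly_Mapping.single (Poly_Mapping.nth es) (alg_val c) + mpoly_of ts"
  by (simp add: mpoly_of_def)

lemma mpoly_vars_mpoly_of:
  assumes "\<forall>(c, es)\<in>set ts. length es = d"
  shows "mpoly_vars (mpoly_of ts) \<subseteq> {..<d}"
  using assms
proof (induction ts)
  case Nil
  then show ?case by (simp add: mpoly_vars_def)
next
  case (Cons t ts)
  obtain c es where t: "t = (c, es)" by (cases t)
  have "Poly_Mapping.keys (Poly_Mapping.nth es) \<subseteq> {..<d}"
    using Cons.prems by (auto simp: t in_set_enumerate_eq)
  moreover have "mpoly_vars (mpoly_of (t # ts)) \<subseteq>
      mpoly_vars (Poly_Mapping.single (Poly_Mapping.nth es) (alg_val c)) \<union> mpoly_vars (mpoly_of ts)"
    using keys_add unfolding mpoly_vars_def t mpoly_of_Cons by fast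
  moreover have "mpoly_vars (Poly_Mapping.single (Poly_Mapping.nth es) (alg_val c)) \<subseteq>
      Poly_Mapping.keys (Poly_Mapping.nth es)"
    by (auto simp: mpoly_vars_def split: if_splits)
  moreover have "mpoly_vars (mpoly_of ts) \<subseteq> {..<d}" using Cons by simp
  ultimately show ?case by blast
qed

lemma algebraic_set_set_of:
  assumes "valid_set d ps"
  shows "algebraic_set d (set_of d ps)"
  unfolding algebraic_set_def set_of_def
proof (intro exI[of _ "mpoly_of ` set ps"] conjI ballI)
  fix p assume "p \<in> mpoly_of ` set ps"
  then show "mpoly_vars p \<subseteq> {..<d}"
    using assms by (fastforce simp: valid_set_def valid_mpoly_def intro!: mpoly_vars_mpoly_of)
qed auto

lemma switching_system_eq_guards_system_of:
  assumes "valid_system C"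
  shows "switching_system_eq_guards (system_of C)"
proof -
  obtain d ls es where C: "C = (d, ls, es)" by (cases C)
  have edges: "p < length ls \<and> q < length ls \<and> valid_set d G" if "(p, G, q) \<in> set es" for p G q
    using assms that by (auto simp: valid_system_def C)
  have locs: "length (fst (ls ! q)) = d \<and>
      (\<forall>row\<in>set (fst (ls ! q)). length row = d \<and> (\<forall>c\<in>set row. valid_alg c)) \<and>
      valid_set d (snd (ls ! q))" if "q < length ls" for q
    using assms nth_mem[OF that] by (cases "ls ! q") (auto simp: valid_system_def C)
  have alg: "algebraic (alg_val (fst (ls ! q) ! i ! j))" if "q < length ls" "i < d" "j < d" for q i j
    using locs[OF that(1)] that by (intro valid_alg_algebraic) (metis nth_mem)
  have row: "length (fst (ls ! q) ! i) = d" if "q < length ls" "i < d" for q i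
    using locs[OF that(1)] that by (metis nth_mem)
  show ?thesis
    unfolding switching_system_eq_guards_def
    using edges locs alg row
    by (auto simp: system_of_def C mat_of_rows_list_def intro!: algebraic_set_set_of)
qed


section \<open>Encoding as natural numbers\<close>

definition encode_list :: "('a \<Rightarrow> nat) \<Rightarrow> 'a list \<Rightarrow> nat" where
  "encode_list e xs = list_encode (map e xs)"

definition encode_pair :: "('a \<Rightarrow> nat) \<Rightarrow> ('b \<Rightarrow> nat) \<Rightarrow> 'a \<times> 'b \<Rightarrow> nat" where
  "encode_pair e e' z = prod_encode (map_prod e e' z)"

definition encode_rat :: "rat \<Rightarrow> nat" where
  "encode_rat r = encode_pair int_encode int_encode (quotient_of r)"

definition encode_alg :: "alg_code \<Rightarrow> nat" where
  "encode_alg =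
     encode_pair (\<lambda>p. encode_list int_encode (coeffs p)) (encode_pair encode_rat encode_rat)"

definition encode_mpoly :: "mpoly_code \<Rightarrow> nat" where
  "encode_mpoly = encode_list (encode_pair encode_alg list_encode)"

definition encode_set :: "set_code \<Rightarrow> nat" where
  "encode_set = encode_list encode_mpoly"

definition encode_system :: "system_code \<Rightarrow> nat" where
  "encode_system =
     encode_pair id
       (encode_pair
         (encode_list (encode_pair (encode_list (encode_list encode_alg)) encode_set))
         (encode_list (encode_pair id (encode_pair encode_set id))))"

definition encode_family :: "set_code list \<Rightarrow> nat" where
  "encode_family = encode_list encode_set"

lemma inj_encode_list: "inj e \<Longrightarrow> inj (encode_list e)"
  by (auto simp: inj_def encode_list_def list_encode_eq intro: list.inj_map_strong)

lemma inj_encode_pair: "inj e \<Longrightarrow> inj e' \<Longrightarrow> inj (encode_pair e e')"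
  by (auto simp: inj_def encode_pair_def)

lemma inj_encode_alg: "inj encode_alg"
proof -
  have "inj (\<lambda>p :: int poly. encode_list int_encode (coeffs p))"
    using inj_encode_list[OF inj_int_encode] by (auto simp: inj_def coeffs_eq_iff)
  moreover have "inj encode_rat"
    using inj_encode_pair[OF inj_int_encode inj_int_encode] quotient_of_inject
    unfolding encode_rat_def inj_def by blast
  ultimately show ?thesis
    unfolding encode_alg_def by (intro inj_encode_pair)
qed

lemma inj_encode_set: "inj encode_set"
  unfolding encode_set_def encode_mpoly_def
  by (intro inj_encode_list inj_encode_pair inj_encode_alg inj_list_encode)

lemma inj_encode_system: "inj encode_system"
  unfolding encode_system_def
  by (intro inj_encode_list inj_encode_pair inj_encode_alg inj_encode_set inj_on_id)

lemma inj_encode_family: "inj encode_family"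
  unfolding encode_family_def by (intro inj_encode_list inj_encode_set)

end

theory Submission
  imports Defs
begin

text \<open>Programs of a register machine become switching systems: a register with content \<open>n\<close> is a coordinate with
  value \<open>2 ^ n\<close>, every flow multiplies some coordinates by \<open>e\<^sup>t\<close>, and a guarded clock coordinate forces a register to
  be exactly doubled or halved. If the program halts, its finitely many configurations yield a small explicit
  invariant. If a register is unbounded along the run, locations that let all other coordinates flow freely
  force every invariant there to be the whole space, since a Zariski closed set that contains all
  \<open>2 ^ n\<close> on a line contains the line. So from the strongest invariant one could decide whether such a program halts.
  A program that computes the code of its own system and halts iff it is told that it diverges gives
  the contradiction.\<close>

section \<open>Polynomial functions and algebraic sets\<close>

text \<open>The flows run only forward and merely rescale coordinates. What they cannot do becomes
  possible because invariants are closed, not because trajectories do it: an orbit is a line in the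
  factor \<open>exp t\<close>, so an algebraic invariant that contains it for all t \<ge> 0 contains
  it for every real factor. This supplies the factor 1/2 of a decrement, which would need negative
  time, and arbitrary clock values. A disequality r \<noteq> 1 is no algebraic guard, but y * (r -
  1) = 1 is one, and it is solvable in the free clock y exactly if r \<noteq> 1 (Rabinowitsch's
  trick). Self-reference needs no recursion theorem: the program text is fixed first, and its input
  \<open>e\<close> is part of the initial set, as an exponent, so that the code of the system
  contains \<open>e\<close> literally. Codes of polynomials have no zero coefficients, so the whole
  space is recognised from the shape of a code alone: it is a list of empty polynomials. The length
  of that list is not known in advance, so the program searches for it. The search counter is
  register 2, which is why the \<open>Blow\<close> locations spare exactly this register: it takes
  finitely many values if the search succeeds and all values \<open>2 ^ n\<close> if it
  fails.\<close>

definition monomial_eval :: "(nat \<Rightarrow>\<^sub>0 nat) \<Rightarrow> real vec \<Rightarrow> real" where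
  "monomial_eval m x = (\<Prod>i\<in>Poly_Mapping.keys m. (x $ i) ^ Poly_Mapping.lookup m i)"

lemma mpoly_eval_alt:
  "mpoly_eval p x = (\<Sum>m\<in>Poly_Mapping.keys p. Poly_Mapping.lookup p m * monomial_eval m x)"
  by (simp add: mpoly_eval_def monomial_eval_def)

lemma monomial_eval_superset:
  "finite A \<Longrightarrow> Poly_Mapping.keys m \<subseteq> A \<Longrightarrow>
    monomial_eval m x = (\<Prod>i\<in>A. (x $ i) ^ Poly_Mapping.lookup m i)"
  unfolding monomial_eval_def by (rule prod.mono_neutral_left) (auto simp: in_keys_iff)

lemma monomial_eval_add: "monomial_eval (m + n) x = monomial_eval m x * monomial_eval n x"
proof -
  let ?A = "Poly_Mapping.keys m \<union> Poly_Mapping.keys n"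
  have "finite ?A" by simp
  moreover have "Poly_Mapping.keys (m + n) \<subseteq> ?A" by (rule keys_add)
  ultimately show ?thesis
    using monomial_eval_superset[of ?A "m + n" x] monomial_eval_superset[of ?A m x]
      monomial_eval_superset[of ?A n x]
    by (simp add: lookup_add power_add prod.distrib)
qed

lemma mpoly_eval_zero [simp]: "mpoly_eval 0 x = 0"
  by (simp add: mpoly_eval_def)

lemma mpoly_eval_single: "mpoly_eval (Poly_Mapping.single m a) x = a * monomial_eval m x"
  by (simp add: mpoly_eval_alt)

lemma mpoly_eval_add: "mpoly_eval (p + q) x = mpoly_eval p x + mpoly_eval q x"
  unfolding mpoly_eval_alt
  by (rule setsum_keys_plus_distrib[where f = "\<lambda>m a. a * monomial_eval m x"])
    (auto simp: algebra_simps)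

lemma mpoly_eval_sum: "mpoly_eval (\<Sum>i\<in>A. f i) x = (\<Sum>i\<in>A. mpoly_eval (f i) x)"
  by (induction A rule: infinite_finite_induct) (auto simp: mpoly_eval_add)

lemma mpoly_eq_sum_single:
  "p = (\<Sum>m\<in>Poly_Mapping.keys p. Poly_Mapping.single m (Poly_Mapping.lookup p m))"
proof (rule poly_mapping_eqI)
  fix k
  have "Poly_Mapping.lookup (\<Sum>m\<in>Poly_Mapping.keys p. Poly_Mapping.single m (Poly_Mapping.lookup p m)) k =
      (\<Sum>m\<in>Poly_Mapping.keys p. if m = k then Poly_Mapping.lookup p m else 0)"
    by (simp add: lookup_sum lookup_single when_def)
  then show "Poly_Mapping.lookup p k =
      Poly_Mapping.lookup (\<Sum>m\<in>Poly_Mapping.keys p. Poly_Mapping.single m (Poly_Mapping.lookup p m)) k"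
    by (auto simp: in_keys_iff)
qed

lemma mpoly_eval_mult: "mpoly_eval (p * q) x = mpoly_eval p x * mpoly_eval q x"
proof -
  have "p * q = (\<Sum>m\<in>Poly_Mapping.keys p. \<Sum>n\<in>Poly_Mapping.keys q.
      Poly_Mapping.single (m + n) (Poly_Mapping.lookup p m * Poly_Mapping.lookup q n))"
    by (subst mpoly_eq_sum_single[of p], subst mpoly_eq_sum_single[of q])
      (simp add: sum_product mult_single)
  then show ?thesis
    by (simp add: mpoly_eval_sum mpoly_eval_single monomial_eval_add mpoly_eval_alt[of p]
        mpoly_eval_alt[of q] sum_product mult_ac)
qed

lemma mpoly_vars_add: "mpoly_vars (p + q) \<subseteq> mpoly_vars p \<union> mpoly_vars q"
  using keys_add unfolding mpoly_vars_def by fast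

lemma mpoly_vars_mult: "mpoly_vars (p * q) \<subseteq> mpoly_vars p \<union> mpoly_vars q"
  for p q :: "real mpoly"
proof
  fix i assume "i \<in> mpoly_vars (p * q)"
  then obtain m where "m \<in> Poly_Mapping.keys (p * q)" "i \<in> Poly_Mapping.keys m"
    by (auto simp: mpoly_vars_def)
  moreover from this obtain a b where "m = a + b" "a \<in> Poly_Mapping.keys p" "b \<in> Poly_Mapping.keys q"
    using keys_mult by blast
  ultimately show "i \<in> mpoly_vars p \<union> mpoly_vars q"
    using keys_add[of a b] unfolding mpoly_vars_def by blast
qed

text \<open>Stated for functions, so that algebraicity of a set follows from the shape of its
  defining expression, without exhibiting an \<open>mpoly\<close>.\<close>

definition polynomial_function :: "nat \<Rightarrow> (real vec \<Rightarrow> real) \<Rightarrow> bool" where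
  "polynomial_function d F \<longleftrightarrow> (\<exists>p. mpoly_vars p \<subseteq> {..<d} \<and> F = mpoly_eval p)"

lemma polynomial_function_const: "polynomial_function d (\<lambda>x. a)"
  unfolding polynomial_function_def
  by (intro exI[of _ "Poly_Mapping.single 0 a"])
    (auto simp: mpoly_vars_def mpoly_eval_single monomial_eval_def split: if_splits)

lemma polynomial_function_coord: "i < d \<Longrightarrow> polynomial_function d (\<lambda>x. x $ i)"
  unfolding polynomial_function_def
  by (intro exI[of _ "Poly_Mapping.single (Poly_Mapping.single i 1) 1"])
    (auto simp: mpoly_vars_def mpoly_eval_single monomial_eval_def split: if_splits)

lemma polynomial_function_add:
  "polynomial_function d F \<Longrightarrow> polynomial_function d G \<Longrightarrow> polynomial_function d (\<lambda>x. F x + G x)"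
  unfolding polynomial_function_def
proof (elim exE conjE)
  fix p q assume "mpoly_vars p \<subseteq> {..<d}" "F = mpoly_eval p" "mpoly_vars q \<subseteq> {..<d}" "G = mpoly_eval q"
  then show "\<exists>r. mpoly_vars r \<subseteq> {..<d} \<and> (\<lambda>x. F x + G x) = mpoly_eval r"
    using mpoly_vars_add[of p q] by (intro exI[of _ "p + q"]) (auto simp: mpoly_eval_add)
qed

lemma polynomial_function_mult:
  "polynomial_function d F \<Longrightarrow> polynomial_function d G \<Longrightarrow> polynomial_function d (\<lambda>x. F x * G x)"
  unfolding polynomial_function_def
proof (elim exE conjE)
  fix p q assume "mpoly_vars p \<subseteq> {..<d}" "F = mpoly_eval p" "mpoly_vars q \<subseteq> {..<d}" "G = mpoly_eval q"
  then show "\<exists>r. mpoly_vars r \<subseteq> {..<d} \<and> (\<lambda>x. F x * G x) = mpoly_eval r"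
    using mpoly_vars_mult[of p q] by (intro exI[of _ "p * q"]) (auto simp: mpoly_eval_mult)
qed

lemmas polynomial_function_intros =
  polynomial_function_const polynomial_function_coord polynomial_function_add
  polynomial_function_mult

lemma polynomial_function_diff:
  assumes "polynomial_function d F" "polynomial_function d G"
  shows "polynomial_function d (\<lambda>x. F x - G x)"
proof -
  have "polynomial_function d (\<lambda>x. F x + (- 1) * G x)"
    using assms by (intro polynomial_function_intros)
  then show ?thesis by simp
qed

lemma algebraic_set_carrier: "algebraic_set d (carrier_vec d)"
  unfolding algebraic_set_def by (intro exI[of _ "{}"]) (auto simp: zero_set_def)

lemma algebraic_set_zeros:
  "polynomial_function d F \<Longrightarrow> algebraic_set d {x \<in> carrier_vec d. F x = 0}"
  unfolding algebraic_set_def polynomial_function_def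
proof (elim exE conjE)
  fix p assume "mpoly_vars p \<subseteq> {..<d}" "F = mpoly_eval p"
  then show "\<exists>ps. finite ps \<and> (\<forall>p\<in>ps. mpoly_vars p \<subseteq> {..<d}) \<and> {x \<in> carrier_vec d. F x = 0} = zero_set d ps"
    by (intro exI[of _ "{p}"]) (auto simp: zero_set_def)
qed

lemma algebraic_set_Int: "algebraic_set d V \<Longrightarrow> algebraic_set d W \<Longrightarrow> algebraic_set d (V \<inter> W)"
  unfolding algebraic_set_def
proof (elim exE conjE)
  fix ps qs
  assume "finite ps" "\<forall>p\<in>ps. mpoly_vars p \<subseteq> {..<d}" "V = zero_set d ps"
    "finite qs" "\<forall>p\<in>qs. mpoly_vars p \<subseteq> {..<d}" "W = zero_set d qs"
  then show "\<exists>ps. finite ps \<and> (\<forall>p\<in>ps. mpoly_vars p \<subseteq> {..<d}) \<and> V \<inter> W = zero_set d ps"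
    by (intro exI[of _ "ps \<union> qs"]) (auto simp: zero_set_def)
qed

text \<open>A point outside both sets violates some \<open>p\<close> and some \<open>q\<close>,
  hence also the product \<open>p * q\<close>.\<close>

lemma algebraic_set_Un: "algebraic_set d V \<Longrightarrow> algebraic_set d W \<Longrightarrow> algebraic_set d (V \<union> W)"
  unfolding algebraic_set_def
proof (elim exE conjE)
  fix ps qs :: "real mpoly set"
  assume *: "finite ps" "\<forall>p\<in>ps. mpoly_vars p \<subseteq> {..<d}" "V = zero_set d ps"
    "finite qs" "\<forall>p\<in>qs. mpoly_vars p \<subseteq> {..<d}" "W = zero_set d qs"
  let ?rs = "(\<lambda>(p, q). p * q) ` (ps \<times> qs)"
  have "\<forall>r\<in>?rs. mpoly_vars r \<subseteq> {..<d}"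
    using * mpoly_vars_mult by fastforce
  moreover have "V \<union> W = zero_set d ?rs"
    using * by (auto simp: zero_set_def mpoly_eval_mult)
  ultimately show "\<exists>ps. finite ps \<and> (\<forall>p\<in>ps. mpoly_vars p \<subseteq> {..<d}) \<and> V \<union> W = zero_set d ps"
    using * by (intro exI[of _ ?rs]) auto
qed

lemma algebraic_set_empty: "algebraic_set d {}"
  using algebraic_set_zeros[OF polynomial_function_const, of d 1] by simp

lemma algebraic_set_UN:
  "finite I \<Longrightarrow> (\<And>i. i \<in> I \<Longrightarrow> algebraic_set d (V i)) \<Longrightarrow> algebraic_set d (\<Union>i\<in>I. V i)"
  by (induction I rule: finite_induct) (auto simp: algebraic_set_empty intro: algebraic_set_Un)

lemma algebraic_set_Ball:
  assumes "finite I" "\<And>i. i \<in> I \<Longrightarrow> polynomial_function d (F i)"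
  shows "algebraic_set d {x \<in> carrier_vec d. \<forall>i\<in>I. F i x = 0}"
  using assms
proof (induction I rule: finite_induct)
  case empty
  then show ?case using algebraic_set_carrier by simp
next
  case (insert i I)
  have "{x \<in> carrier_vec d. \<forall>i\<in>insert i I. F i x = 0} =
      {x \<in> carrier_vec d. F i x = 0} \<inter> {x \<in> carrier_vec d. \<forall>i\<in>I. F i x = 0}"
    by auto
  then show ?case using insert algebraic_set_zeros algebraic_set_Int by auto
qed

lemma algebraic_set_subset_carrier: "algebraic_set d V \<Longrightarrow> V \<subseteq> carrier_vec d"
  by (auto simp: algebraic_set_def zero_set_def)

section \<open>Polynomial curves inside algebraic sets\<close>

lemma mpoly_eval_curve:
  assumes "mpoly_vars p \<subseteq> {..<d}"
  shows "\<exists>P. \<forall>t. mpoly_eval p (vec d (\<lambda>i. poly (L i) t)) = poly P t"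
proof -
  let ?P = "\<Sum>m\<in>Poly_Mapping.keys p. Polynomial.smult (Poly_Mapping.lookup p m)
      (\<Prod>i\<in>Poly_Mapping.keys m. L i ^ Poly_Mapping.lookup m i)"
  have "mpoly_eval p (vec d (\<lambda>i. poly (L i) t)) = poly ?P t" for t
  proof -
    have "monomial_eval m (vec d (\<lambda>i. poly (L i) t)) =
        poly (\<Prod>i\<in>Poly_Mapping.keys m. L i ^ Poly_Mapping.lookup m i) t"
      if "m \<in> Poly_Mapping.keys p" for m
    proof -
      have "i < d" if "i \<in> Poly_Mapping.keys m" for i
        using assms that \<open>m \<in> _\<close> by (auto simp: mpoly_vars_def)
      then show ?thesis by (simp add: monomial_eval_def poly_prod)
    qed
    then show ?thesis by (simp add: mpoly_eval_alt poly_sum)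
  qed
  then show ?thesis by blast
qed

text \<open>Along the curve a defining polynomial becomes univariate, and infinitely many roots make
  it zero. Applied to flows, where \<open>T\<close> is a half-line, and to the powers of two in
  register 2.\<close>

lemma algebraic_set_curve:
  assumes V: "algebraic_set d V"
    and T: "infinite T" "\<And>t. t \<in> T \<Longrightarrow> vec d (\<lambda>i. poly (L i) t) \<in> V"
  shows "vec d (\<lambda>i. poly (L i) t) \<in> V"
proof -
  obtain ps where ps: "\<forall>p\<in>ps. mpoly_vars p \<subseteq> {..<d}" "V = zero_set d ps"
    using V by (auto simp: algebraic_set_def)
  have "mpoly_eval p (vec d (\<lambda>i. poly (L i) t)) = 0" if p: "p \<in> ps" for p
  proof -
    obtain P where P: "\<And>t. mpoly_eval p (vec d (\<lambda>i. poly (L i) t)) = poly P t"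
      using mpoly_eval_curve ps(1) p by blast
    have "T \<subseteq> {t. poly P t = 0}"
    proof
      fix t assume "t \<in> T"
      then have "mpoly_eval p (vec d (\<lambda>i. poly (L i) t)) = 0"
        using T(2)[of t] p by (simp add: ps(2) zero_set_def)
      then show "t \<in> {t. poly P t = 0}" using P by simp
    qed
    then have "P = 0" using T(1) poly_roots_finite finite_subset by blast
    then show ?thesis using P by simp
  qed
  then show ?thesis by (simp add: ps(2) zero_set_def)
qed

section \<open>Diagonal dynamics\<close>

lemma diag_mat_pow:
  "(mat d d (\<lambda>(i, j). if i = j then a i else (0::real))) ^\<^sub>m k =
     mat d d (\<lambda>(i, j). if i = j then a i ^ k else 0)"
proof (induction k)
  case 0
  then show ?case by (intro eq_matI) auto
next
  case (Suc k)
  have "(\<Sum>l = 0..<d. (if i = l then a i ^ k else 0) * (if l = j then a l else 0)) =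
      (if i = j then a i ^ k * a i else 0)" if "i < d" for i j
  proof -
    have "(\<Sum>l = 0..<d. (if i = l then a i ^ k else 0) * (if l = j then a l else 0)) =
        (\<Sum>l = 0..<d. if l = i then a i ^ k * (if i = j then a i else 0) else 0)"
      by (rule sum.cong) auto
    then show ?thesis using that by simp
  qed
  then show ?case
    by (auto simp: Suc scalar_prod_def mult.commute intro!: eq_matI)
qed

lemma mat_exp_diag:
  "mat_exp (t \<cdot>\<^sub>m mat d d (\<lambda>(i, j). if i = j then a i else 0)) =
     mat d d (\<lambda>(i, j). if i = j then exp (t * a i) else 0)"
proof -
  have "t \<cdot>\<^sub>m mat d d (\<lambda>(i, j). if i = j then a i else 0) =
      mat d d (\<lambda>(i, j). if i = j then t * a i else 0)"
    by (intro eq_matI) auto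
  moreover have "suminf (\<lambda>k. (t * a i) ^ k / fact k) = exp (t * a i)" for i
    by (simp add: exp_def divide_inverse_commute)
  ultimately show ?thesis
    unfolding mat_exp_def by (auto simp: diag_mat_pow intro!: eq_matI)
qed

lemma diag_mat_mult_vec:
  assumes "x \<in> carrier_vec d"
  shows "mat d d (\<lambda>(i, j). if i = j then a i else 0) *\<^sub>v x = vec d (\<lambda>i. a i * x $ i)"
proof (intro eq_vecI)
  fix i assume i: "i < dim_vec (vec d (\<lambda>i. a i * x $ i))"
  have "(\<Sum>l = 0..<d. (if i = l then a i else 0) * x $ l) = (\<Sum>l = 0..<d. if l = i then a i * x $ i else 0)"
    by (rule sum.cong) auto
  then show "(mat d d (\<lambda>(i, j). if i = j then a i else 0) *\<^sub>v x) $ i = vec d (\<lambda>i. a i * x $ i) $ i"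
    using i assms by (simp add: scalar_prod_def)
qed auto

definition scale :: "nat \<Rightarrow> nat set \<Rightarrow> real \<Rightarrow> real vec \<Rightarrow> real vec" where
  "scale d J u x = vec d (\<lambda>i. if i \<in> J then u * x $ i else x $ i)"

definition scaling_mat :: "nat \<Rightarrow> nat set \<Rightarrow> real mat" where
  "scaling_mat d J = mat d d (\<lambda>(i, j). if i = j \<and> i \<in> J then 1 else 0)"

lemma mat_exp_scaling_mat:
  assumes "x \<in> carrier_vec d"
  shows "mat_exp (t \<cdot>\<^sub>m scaling_mat d J) *\<^sub>v x = scale d J (exp t) x"
proof -
  have "scaling_mat d J = mat d d (\<lambda>(i, j). if i = j then of_bool (i \<in> J) else 0)"
    by (auto simp: scaling_mat_def intro!: eq_matI)
  then show ?thesis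
    using assms by (auto simp: mat_exp_diag diag_mat_mult_vec scale_def intro!: eq_vecI)
qed

text \<open>The flow itself yields only the factors \<open>exp t\<close> with t \<ge> 0. Closedness
  adds all other real \<open>u\<close>, in particular those of negative time and u = 0.\<close>

lemma scale_in_algebraic_set:
  assumes V: "algebraic_set d V" and x: "x \<in> V"
    and flow: "\<And>t x. t \<ge> 0 \<Longrightarrow> x \<in> V \<Longrightarrow> mat_exp (t \<cdot>\<^sub>m scaling_mat d J) *\<^sub>v x \<in> V"
  shows "scale d J u x \<in> V"
proof -
  have carrier: "x \<in> carrier_vec d" using V x algebraic_set_subset_carrier by blast
  \<comment> \<open>Parametrised by the factor instead of by time, the orbit is a straight
    line.\<close>
  let ?L = "\<lambda>i. if i \<in> J then [:0, x $ i:] else [:x $ i:]"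
  have curve: "scale d J u x = vec d (\<lambda>i. poly (?L i) u)" for u
    by (auto simp: scale_def intro!: eq_vecI)
  have "infinite {1::real..}" by (rule infinite_Ici)
  moreover have "vec d (\<lambda>i. poly (?L i) u) \<in> V" if "u \<in> {1..}" for u
    using flow[OF _ x, of "ln u"] that by (simp add: mat_exp_scaling_mat[OF carrier] curve[symmetric])
  ultimately show ?thesis
    unfolding curve by (rule algebraic_set_curve[OF V])
qed

section \<open>Register programs\<close>

datatype com = Skip | Upd nat bool | Seq com com | While nat com

datatype act = Tau | Scale nat bool | Is_one nat | Not_one nat

text \<open>Program points are the programs that remain to be run. Successors do not depend on the
  state: tests are moved into the labels, which later become guards of edges.\<close>

fun succs :: "com \<Rightarrow> (act \<times> com) list" where
  "succs Skip = []"
| "succs (Upd r b) = [(Scale r b, Skip)]"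
| "succs (Seq c d) =
     (if c = Skip then [(Tau, d)] else map (\<lambda>(l, c'). (l, Seq c' d)) (succs c))"
| "succs (While r c) = [(Is_one r, Skip), (Not_one r, Seq c (While r c))]"

fun enabled :: "act \<Rightarrow> (nat \<Rightarrow> real) \<Rightarrow> bool" where
  "enabled (Is_one r) s = (s r = 1)"
| "enabled (Not_one r) s = (s r \<noteq> 1)"
| "enabled _ s = True"

text \<open>The clock runs from 1 to 2 for an increment and from 2 to 1 for a decrement; the
  quotient is the factor that the register acquires.\<close>

definition clock_in :: "bool \<Rightarrow> nat" where "clock_in b = (if b then 1 else 2)"
definition clock_out :: "bool \<Rightarrow> nat" where "clock_out b = (if b then 2 else 1)"

fun effect :: "act \<Rightarrow> (nat \<Rightarrow> real) \<Rightarrow> nat \<Rightarrow> real" where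
  "effect (Scale r b) s = s(r := s r / real (clock_in b) * real (clock_out b))"
| "effect _ s = s"

inductive step :: "com \<times> (nat \<Rightarrow> real) \<Rightarrow> com \<times> (nat \<Rightarrow> real) \<Rightarrow> bool" where
  step: "(l, c') \<in> set (succs c) \<Longrightarrow> enabled l s \<Longrightarrow> step (c, s) (c', effect l s)"

abbreviation steps where "steps \<equiv> step\<^sup>*\<^sup>*"

definition run :: "com \<Rightarrow> (nat \<Rightarrow> real) \<Rightarrow> (nat \<Rightarrow> real) \<Rightarrow> bool" where
  "run c s s' \<longleftrightarrow> steps (c, s) (Skip, s')"

text \<open>Unfolding a loop always puts the same \<open>While r c\<close> behind the rest of its
  body, so finitely many program points suffice. They become the control locations.\<close>

fun residuals :: "com \<Rightarrow> com list" where
  "residuals Skip = [Skip]"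
| "residuals (Upd r b) = [Upd r b, Skip]"
| "residuals (Seq c d) = map (\<lambda>c'. Seq c' d) (residuals c) @ residuals d"
| "residuals (While r c) = While r c # Skip # map (\<lambda>c'. Seq c' (While r c)) (residuals c)"

lemma self_in_residuals: "c \<in> set (residuals c)"
  by (induction c) auto

lemma residuals_succs:
  "c' \<in> set (residuals c) \<Longrightarrow> (l, c'') \<in> set (succs c') \<Longrightarrow> c'' \<in> set (residuals c)"
proof (induction c arbitrary: c' l c'')
  case (Seq c d)
  then show ?case
    using self_in_residuals[of d] by (auto split: if_splits)
next
  case (While r c)
  then show ?case
    using self_in_residuals[of c] by (auto split: if_splits)
qed auto

lemma steps_residuals: "steps (c, s) (c', s') \<Longrightarrow> c' \<in> set (residuals c)"
  by (induction "(c', s')" arbitrary: c' s' rule: rtranclp_induct)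
    (auto simp: self_in_residuals elim!: step.cases intro: residuals_succs)

lemma succs_deterministic:
  "(l, c') \<in> set (succs c) \<Longrightarrow> (l', c'') \<in> set (succs c) \<Longrightarrow> enabled l s \<Longrightarrow> enabled l' s \<Longrightarrow>
    l = l' \<and> c' = c''"
  by (induction c arbitrary: c' c'') (auto split: if_splits)

lemma step_deterministic: "step (c, s) x \<Longrightarrow> step (c, s) y \<Longrightarrow> x = y"
  by (auto elim!: step.cases dest: succs_deterministic)

lemma no_step_Skip: "\<not> step (Skip, s) x"
  by (auto elim: step.cases)

text \<open>By determinism every reachable configuration lies on the one run to \<open>Skip\<close>,
  and \<open>Skip\<close> has no successor.\<close>

lemma finite_reachable:
  assumes "run c s s'"
  shows "finite {x. steps (c, s) x}"
  using assms unfolding run_def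
proof (induction "(c, s)" arbitrary: c s rule: converse_rtranclp_induct)
  case base
  have "{x. steps (Skip, s') x} = {(Skip, s')}"
    using no_step_Skip by (auto elim: converse_rtranclpE)
  then show ?case by simp
next
  case (step y)
  have "{x. steps (c, s) x} \<subseteq> insert (c, s) {x. steps y x}"
  proof
    fix x assume "x \<in> {x. steps (c, s) x}"
    then have "steps (c, s) x" by simp
    then show "x \<in> insert (c, s) {x. steps y x}"
      by (cases rule: converse_rtranclpE) (auto dest: step_deterministic[OF step(1)])
  qed
  moreover have "finite {x. steps y x}"
    using step(3) by (cases y) auto
  ultimately show ?case by (meson finite_insert finite_subset)
qed

text \<open>Scaling cannot move a coordinate away from zero; positivity is what lets the
  \<open>Blow\<close> locations change every register but register 2.\<close>

lemma steps_pos: "steps (c, s) (c', s') \<Longrightarrow> \<forall>r. s r > 0 \<Longrightarrow> s' r > 0"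
proof (induction "(c', s')" arbitrary: c' s' r rule: rtranclp_induct)
  case (step y)
  obtain d t where y: "y = (d, t)" by (cases y)
  with step have "t i > 0" for i by blast
  moreover obtain l where "s' = effect l t"
    using step y by (auto elim: step.cases)
  ultimately show ?case
    by (cases l) (auto simp: clock_in_def clock_out_def)
qed auto

lemma steps_Seq: "steps (c, s) (c', s') \<Longrightarrow> steps (Seq c d, s) (Seq c' d, s')"
proof (induction "(c', s')" arbitrary: c' s' rule: rtranclp_induct)
  case (step y)
  obtain e t where y: "y = (e, t)" by (cases y)
  have "step (Seq e d, t) (Seq c' d, s')"
    using step(2) unfolding y by (force elim!: step.cases intro!: step.intros)
  moreover have "steps (Seq c d, s) (Seq e d, t)" using step(3) y by blast
  ultimately show ?case by (rule rtranclp.rtrancl_into_rtrancl[rotated])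
qed auto

lemma run_Skip: "run Skip s s"
  by (simp add: run_def)

lemma run_Upd: "run (Upd r b) s (effect (Scale r b) s)"
  unfolding run_def by (intro r_into_rtranclp step.intros) auto

lemma step_Seq_Skip: "step (Seq Skip d, s) (d, s)"
  using step.intros[of Tau d "Seq Skip d" s] by auto

lemma steps_Seq_run: "run c s s' \<Longrightarrow> steps (Seq c d, s) (d, s')"
  unfolding run_def using steps_Seq step_Seq_Skip by (meson rtranclp.rtrancl_into_rtrancl)

lemma run_Seq: "run c s s' \<Longrightarrow> run d s' s'' \<Longrightarrow> run (Seq c d) s s''"
  using steps_Seq_run unfolding run_def by (metis rtranclp_trans)

lemma run_While_one: "s r = 1 \<Longrightarrow> run (While r c) s s"
  unfolding run_def using step.intros[of "Is_one r" Skip "While r c" s] by auto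

lemma steps_While: "s r \<noteq> 1 \<Longrightarrow> run c s s' \<Longrightarrow> steps (While r c, s) (While r c, s')"
  using step.intros[of "Not_one r" "Seq c (While r c)" "While r c" s] steps_Seq_run[of c s s' "While r c"]
  by auto

lemma run_While_step: "s r \<noteq> 1 \<Longrightarrow> run c s s' \<Longrightarrow> run (While r c) s' s'' \<Longrightarrow> run (While r c) s s''"
  using steps_While unfolding run_def by (metis rtranclp_trans)

text \<open>A register that represents the number \<open>n\<close> holds \<open>2 ^ n\<close>, so that doubling and halving a
  register are increment and decrement.\<close>

definition repr :: "(nat \<Rightarrow> nat) \<Rightarrow> nat \<Rightarrow> real" where
  "repr \<sigma> r = 2 ^ \<sigma> r"

definition exec :: "com \<Rightarrow> (nat \<Rightarrow> nat) \<Rightarrow> (nat \<Rightarrow> nat) \<Rightarrow> bool" where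
  "exec c \<sigma> \<sigma>' \<longleftrightarrow> run c (repr \<sigma>) (repr \<sigma>')"

abbreviation "increment r \<equiv> Upd r True"
abbreviation "decrement r \<equiv> Upd r False"

lemma exec_increment: "exec (increment r) \<sigma> (\<sigma>(r := Suc (\<sigma> r)))"
proof -
  have "effect (Scale r True) (repr \<sigma>) = repr (\<sigma>(r := Suc (\<sigma> r)))"
    by (auto simp: repr_def clock_in_def clock_out_def)
  then show ?thesis unfolding exec_def by (metis run_Upd)
qed

text \<open>A register that represents 0 would become 1/2, which represents no number.\<close>

lemma exec_decrement: "\<sigma> r = Suc n \<Longrightarrow> exec (decrement r) \<sigma> (\<sigma>(r := n))"
proof -
  assume "\<sigma> r = Suc n"
  then have "effect (Scale r False) (repr \<sigma>) = repr (\<sigma>(r := n))"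
    by (auto simp: repr_def clock_in_def clock_out_def)
  then show ?thesis unfolding exec_def by (metis run_Upd)
qed

lemma repr_eq_1_iff: "repr \<sigma> r = 1 \<longleftrightarrow> \<sigma> r = 0"
  unfolding repr_def
  by (metis less_irrefl neq0_conv one_less_numeral_iff one_less_power power_0 semiring_norm(76))

lemma exec_Skip: "exec Skip \<sigma> \<sigma>"
  unfolding exec_def by (rule run_Skip)

lemma exec_Seq: "exec c \<sigma> \<sigma>' \<Longrightarrow> exec d \<sigma>' \<sigma>'' \<Longrightarrow> exec (Seq c d) \<sigma> \<sigma>''"
  unfolding exec_def by (rule run_Seq)

lemma exec_While_zero: "\<sigma> r = 0 \<Longrightarrow> exec (While r c) \<sigma> \<sigma>"
  unfolding exec_def by (rule run_While_one) (simp add: repr_eq_1_iff)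

lemma exec_While_step:
  "\<sigma> r \<noteq> 0 \<Longrightarrow> exec c \<sigma> \<sigma>' \<Longrightarrow> exec (While r c) \<sigma>' \<sigma>'' \<Longrightarrow> exec (While r c) \<sigma> \<sigma>''"
  unfolding exec_def by (rule run_While_step) (simp_all add: repr_eq_1_iff)

text \<open>The rule for counting loops: the invariant is indexed by the number of rounds left,
  which is the content of the loop register.\<close>

lemma exec_countdown:
  assumes body: "\<And>n \<sigma>. I (Suc n) \<sigma> \<Longrightarrow> \<exists>\<sigma>'. exec c \<sigma> \<sigma>' \<and> I n \<sigma>'"
    and count: "\<And>n \<sigma>. I n \<sigma> \<Longrightarrow> \<sigma> r = n"
  shows "I n \<sigma> \<Longrightarrow> \<exists>\<sigma>'. exec (While r c) \<sigma> \<sigma>' \<and> I 0 \<sigma>'"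
proof (induction n arbitrary: \<sigma>)
  case 0
  then show ?case using count exec_While_zero by blast
next
  case (Suc n)
  from body[OF Suc.prems] obtain \<sigma>1 where "exec c \<sigma> \<sigma>1" "I n \<sigma>1" by blast
  moreover have "\<sigma> r \<noteq> 0" using count[OF Suc.prems] by simp
  ultimately show ?case using Suc.IH exec_While_step by blast
qed

section \<open>Clearing and copying registers\<close>

definition clear :: "nat \<Rightarrow> com" where
  "clear r = While r (decrement r)"

lemma exec_clear: "exec (clear r) \<sigma> (\<sigma>(r := 0))"
proof -
  have "\<exists>\<sigma>'. exec (While r (decrement r)) \<sigma> \<sigma>' \<and> \<sigma>' = \<sigma>(r := 0)"
    by (rule exec_countdown[where I = "\<lambda>n \<sigma>'. \<sigma>' = \<sigma>(r := n)" and n = "\<sigma> r"])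
      (use exec_decrement[of "\<sigma>(r := Suc n)" r n for n] in auto)
  then show ?thesis by (auto simp: clear_def)
qed

text \<open>A register can be read only by emptying it, so \<open>a\<close> is drained into both
  \<open>b\<close> and \<open>t\<close> and then restored from \<open>t\<close>.\<close>

definition copy :: "nat \<Rightarrow> nat \<Rightarrow> nat \<Rightarrow> com" where
  "copy a b t = Seq (clear b) (Seq (clear t)
     (Seq (While a (Seq (decrement a) (Seq (increment b) (increment t))))
          (While t (Seq (decrement t) (increment a)))))"

lemma exec_copy:
  assumes "a \<noteq> b" "a \<noteq> t" "b \<noteq> t"
  shows "exec (copy a b t) \<sigma> (\<sigma>(b := \<sigma> a, t := 0))"
proof -
  let ?k = "\<sigma> a"
  \<comment> \<open>The states of the draining and of the restoring loop with \<open>n\<close>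
    rounds left.\<close>
  let ?s1 = "\<lambda>n. \<sigma>(a := n, b := ?k - n, t := ?k - n)"
  let ?s2 = "\<lambda>n. \<sigma>(a := ?k - n, b := ?k, t := n)"
  have s1: "exec (While a (Seq (decrement a) (Seq (increment b) (increment t)))) (?s1 ?k) (?s1 0)"
  proof -
    have "\<exists>\<sigma>'. exec (Seq (decrement a) (Seq (increment b) (increment t))) (?s1 (Suc n)) \<sigma>' \<and> \<sigma>' = ?s1 n"
      if "Suc n \<le> ?k" for n
    proof -
      let ?t0 = "(?s1 (Suc n))(a := n)"
      let ?t1 = "?t0(b := Suc (?t0 b))"
      let ?t2 = "?t1(t := Suc (?t1 t))"
      have "exec (decrement a) (?s1 (Suc n)) ?t0"
        using assms by (intro exec_decrement) auto
      then have "exec (Seq (decrement a) (Seq (increment b) (increment t))) (?s1 (Suc n)) ?t2"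
        by (rule exec_Seq[OF _ exec_Seq[OF exec_increment exec_increment]])
      moreover have "?t2 = ?s1 n" using assms that by (auto simp: fun_eq_iff Suc_diff_Suc)
      ultimately show ?thesis by auto
    qed
    then have "\<exists>\<sigma>'. exec (While a (Seq (decrement a) (Seq (increment b) (increment t)))) (?s1 ?k) \<sigma>' \<and>
        (0 \<le> ?k \<and> \<sigma>' = ?s1 0)"
      using assms by (intro exec_countdown[where I = "\<lambda>n \<sigma>'. n \<le> ?k \<and> \<sigma>' = ?s1 n" and n = ?k]) auto
    then show ?thesis by auto
  qed
  have s2: "exec (While t (Seq (decrement t) (increment a))) (?s2 ?k) (?s2 0)"
  proof -
    have "\<exists>\<sigma>'. exec (Seq (decrement t) (increment a)) (?s2 (Suc n)) \<sigma>' \<and> \<sigma>' = ?s2 n"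
      if "Suc n \<le> ?k" for n
    proof -
      let ?t0 = "(?s2 (Suc n))(t := n)"
      let ?t1 = "?t0(a := Suc (?t0 a))"
      have "exec (decrement t) (?s2 (Suc n)) ?t0"
        using assms by (intro exec_decrement) auto
      then have "exec (Seq (decrement t) (increment a)) (?s2 (Suc n)) ?t1"
        by (rule exec_Seq[OF _ exec_increment])
      moreover have "?t1 = ?s2 n" using assms that by (auto simp: fun_eq_iff Suc_diff_Suc)
      ultimately show ?thesis by auto
    qed
    then have "\<exists>\<sigma>'. exec (While t (Seq (decrement t) (increment a))) (?s2 ?k) \<sigma>' \<and>
        (0 \<le> ?k \<and> \<sigma>' = ?s2 0)"
      using assms by (intro exec_countdown[where I = "\<lambda>n \<sigma>'. n \<le> ?k \<and> \<sigma>' = ?s2 n" and n = ?k]) auto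
    then show ?thesis by auto
  qed
  have eqs: "\<sigma>(b := 0, t := 0) = ?s1 ?k" "?s1 0 = ?s2 ?k" "?s2 0 = \<sigma>(b := \<sigma> a, t := 0)"
    using assms by (auto simp: fun_eq_iff)
  have "exec (Seq (While a (Seq (decrement a) (Seq (increment b) (increment t))))
      (While t (Seq (decrement t) (increment a)))) (\<sigma>(b := 0, t := 0)) (\<sigma>(b := \<sigma> a, t := 0))"
    unfolding eqs(1) eqs(3)[symmetric] using s1[unfolded eqs(2)] s2 by (rule exec_Seq)
  then show ?thesis
    unfolding copy_def by (intro exec_Seq[OF exec_clear exec_Seq[OF exec_clear]])
qed

section \<open>Compilation of recursive functions to register programs\<close>

fun compile_all :: "(nat list \<Rightarrow> nat \<Rightarrow> nat \<Rightarrow> com) list \<Rightarrow> nat list \<Rightarrow> nat \<Rightarrow> nat \<Rightarrow> com" where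
  "compile_all [] as d B = Skip"
| "compile_all (h # hs) as d B = Seq (h as d B) (compile_all hs as (Suc d) B)"

text \<open>\<open>compile f as d B\<close> reads its arguments from the registers \<open>as\<close>, writes the value of \<open>f\<close> to the
  register \<open>d\<close>, and uses the registers from \<open>B\<close> on as working space.\<close>

primrec compile :: "recf \<Rightarrow> nat list \<Rightarrow> nat \<Rightarrow> nat \<Rightarrow> com" where
  "compile Zero = (\<lambda>as d B. clear d)"
| "compile Succ = (\<lambda>as d B. Seq (copy (hd as) d B) (increment d))"
| "compile (Proj i) = (\<lambda>as d B. copy (as ! i) d B)"
| "compile (Comp f gs) = (\<lambda>as d B.
     Seq (compile_all (map compile gs) as B (B + length gs))
         (compile f [B..<B + length gs] d (B + length gs)))"
| "compile (PrimRec f g) = (\<lambda>as d B.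
     Seq (copy (hd as) B (B + 3))
    (Seq (clear (B + 1))
    (Seq (compile f (tl as) (B + 2) (B + 4))
    (Seq (While B
           (Seq (decrement B)
           (Seq (compile g ((B + 1) # (B + 2) # tl as) (B + 3) (B + 4))
           (Seq (copy (B + 3) (B + 2) (B + 4))
                (increment (B + 1))))))
         (copy (B + 2) d (B + 3))))))"
| "compile (Minim f) = (\<lambda>as d B.
     Seq (clear B)
    (Seq (compile f (B # as) (B + 1) (B + 2))
    (Seq (While (B + 1) (Seq (increment B) (compile f (B # as) (B + 1) (B + 2))))
         (copy B d (B + 1)))))"

text \<open>Nothing is assumed or promised about the registers from \<open>B\<close> on, apart from
  a result in \<open>d\<close>: code inside a loop meets the leftovers of the previous round
  there.\<close>

definition stores :: "com \<Rightarrow> nat \<Rightarrow> nat \<Rightarrow> nat \<Rightarrow> (nat \<Rightarrow> nat) \<Rightarrow> bool" where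
  "stores c d y B \<sigma> \<longleftrightarrow>
     (\<exists>\<sigma>'. exec c \<sigma> \<sigma>' \<and> \<sigma>' d = y \<and> (\<forall>r<B. r \<noteq> d \<longrightarrow> \<sigma>' r = \<sigma> r))"

definition evaluates :: "(nat list \<Rightarrow> nat \<Rightarrow> nat \<Rightarrow> com) \<Rightarrow> nat list \<Rightarrow> nat \<Rightarrow> bool" where
  "evaluates h xs y \<longleftrightarrow> (\<forall>as d B \<sigma>. map \<sigma> as = xs \<longrightarrow> d < B \<longrightarrow> set as \<subseteq> {..<B} - {d} \<longrightarrow>
     stores (h as d B) d y B \<sigma>)"

lemma evaluatesI:
  "(\<And>as d B \<sigma>. map \<sigma> as = xs \<Longrightarrow> d < B \<Longrightarrow> set as \<subseteq> {..<B} - {d} \<Longrightarrow> stores (h as d B) d y B \<sigma>) \<Longrightarrow>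
    evaluates h xs y"
  by (auto simp: evaluates_def)

lemma evaluatesD:
  assumes "evaluates h xs y" "map \<sigma> as = xs" "d < B" "set as \<subseteq> {..<B} - {d}"
  shows "\<exists>\<sigma>'. exec (h as d B) \<sigma> \<sigma>' \<and> \<sigma>' d = y \<and> (\<forall>r<B. r \<noteq> d \<longrightarrow> \<sigma>' r = \<sigma> r)"
  using assms unfolding evaluates_def stores_def by blast

lemma compile_all:
  assumes "list_all2 (\<lambda>h y. evaluates h xs y) hs ys"
  shows "map \<sigma> as = xs \<Longrightarrow> set as \<subseteq> {..<d} \<Longrightarrow> d + length hs \<le> B \<Longrightarrow>
    \<exists>\<sigma>'. exec (compile_all hs as d B) \<sigma> \<sigma>' \<and> map \<sigma>' [d..<d + length hs] = ys \<and> (\<forall>r<d. \<sigma>' r = \<sigma> r)"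
  using assms
proof (induction hs ys arbitrary: d \<sigma> rule: list_all2_induct)
  case Nil
  then show ?case using exec_Skip by auto
next
  case (Cons h hs y ys)
  have "d < B" "set as \<subseteq> {..<B} - {d}" using Cons.prems by auto
  then obtain \<sigma>1 where s1: "exec (h as d B) \<sigma> \<sigma>1" "\<sigma>1 d = y" "\<And>r. r < B \<Longrightarrow> r \<noteq> d \<Longrightarrow> \<sigma>1 r = \<sigma> r"
    using evaluatesD[OF Cons.hyps(1) Cons.prems(1)] by blast
  have "map \<sigma>1 as = xs"
    using Cons.prems s1(3) by fastforce
  then obtain \<sigma>2 where s2: "exec (compile_all hs as (Suc d) B) \<sigma>1 \<sigma>2"
      "map \<sigma>2 [Suc d..<Suc d + length hs] = ys" "\<forall>r<Suc d. \<sigma>2 r = \<sigma>1 r"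
    using Cons.IH[of \<sigma>1 "Suc d"] Cons.prems by fastforce
  have "map \<sigma>2 [d..<d + length (h # hs)] = y # ys"
    using s1(2) s2(2,3) by (simp add: upt_conv_Cons del: upt_Suc)
  moreover have "\<forall>r<d. \<sigma>2 r = \<sigma> r"
    using s2(3) s1(3) Cons.prems(3) by simp
  ultimately show ?case
    using exec_Seq[OF s1(1) s2(1)] by auto
qed

text \<open>The compiled loop produces these intermediate values one by one, and its invariant
  refers to them.\<close>

lemma rec_eval_PrimRec_values:
  "rec_eval (PrimRec f g) (n # xs) z \<Longrightarrow>
    \<exists>v. rec_eval f xs (v 0) \<and> (\<forall>i<n. rec_eval g (i # v i # xs) (v (Suc i))) \<and> v n = z"
proof (induction n arbitrary: z)
  case 0
  then show ?case by (auto elim!: rec_eval_PrimRec_0E)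
next
  case (Suc n)
  from Suc.prems obtain y where y: "rec_eval (PrimRec f g) (n # xs) y" "rec_eval g (n # y # xs) z"
    by (auto elim: rec_eval_PrimRec_SucE)
  from Suc.IH[OF y(1)] obtain v where
    v: "rec_eval f xs (v 0)" "\<forall>i<n. rec_eval g (i # v i # xs) (v (Suc i))" "v n = y"
    by blast
  have "rec_eval g (i # (v(Suc n := z)) i # xs) ((v(Suc n := z)) (Suc i))" if "i < Suc n" for i
    using that v y(2) by (cases "i = n") auto
  then show ?case using v(1) by (intro exI[of _ "v(Suc n := z)"]) auto
qed

lemma compile_PrimRec:
  assumes f: "\<And>xs y. rec_eval f xs y \<Longrightarrow> evaluates (compile f) xs y"
    and g: "\<And>xs y. rec_eval g xs y \<Longrightarrow> evaluates (compile g) xs y"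
    and z: "rec_eval (PrimRec f g) (n # xs) z"
  shows "evaluates (compile (PrimRec f g)) (n # xs) z"
proof (rule evaluatesI)
  fix as :: "nat list" and d B :: nat and \<sigma> :: "nat \<Rightarrow> nat"
  assume as: "map \<sigma> as = n # xs" "d < B" "set as \<subseteq> {..<B} - {d}"
  then obtain a as' where as': "as = a # as'" "\<sigma> a = n" "map \<sigma> as' = xs" "a < B" "a \<noteq> d"
      "set as' \<subseteq> {..<B} - {d}"
    by (cases as) auto
  obtain v where v: "rec_eval f xs (v 0)" "\<And>i. i < n \<Longrightarrow> rec_eval g (i # v i # xs) (v (Suc i))" "v n = z"
    using rec_eval_PrimRec_values[OF z] by blast
  have map_as': "map \<tau> as' = xs" if "\<forall>r<B. \<tau> r = \<sigma> r" for \<tau>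
    using as' that by (auto simp: map_eq_conv subset_iff)
  define \<sigma>1 where "\<sigma>1 = \<sigma>(B := n, B + 3 := 0)"
  have 1: "exec (copy a B (B + 3)) \<sigma> \<sigma>1"
    using exec_copy[of a B "B + 3" \<sigma>] as' by (simp add: \<sigma>1_def)
  define \<sigma>2 where "\<sigma>2 = \<sigma>1(B + 1 := 0)"
  have 2: "exec (clear (B + 1)) \<sigma>1 \<sigma>2" unfolding \<sigma>2_def by (rule exec_clear)
  have "map \<sigma>2 as' = xs" by (rule map_as') (simp add: \<sigma>1_def \<sigma>2_def)
  moreover have "B + 2 < B + 4" "set as' \<subseteq> {..<B + 4} - {B + 2}" using as'(6) by auto
  ultimately obtain \<sigma>3 where 3: "exec (compile f as' (B + 2) (B + 4)) \<sigma>2 \<sigma>3" "\<sigma>3 (B + 2) = v 0"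
      "\<And>r. r < B + 4 \<Longrightarrow> r \<noteq> B + 2 \<Longrightarrow> \<sigma>3 r = \<sigma>2 r"
    using evaluatesD[OF f[OF v(1)]] by blast
  \<comment> \<open>With \<open>k\<close> rounds left, \<open>B\<close> is the countdown,
    \<open>B + 1\<close> the recursion index and \<open>B + 2\<close> the value so far;
    \<open>B + 3\<close> receives the next value.\<close>
  let ?I = "\<lambda>k \<tau>. k \<le> n \<and> \<tau> B = k \<and> \<tau> (B + 1) = n - k \<and> \<tau> (B + 2) = v (n - k) \<and> (\<forall>r<B. \<tau> r = \<sigma> r)"
  let ?body = "Seq (decrement B)
           (Seq (compile g ((B + 1) # (B + 2) # as') (B + 3) (B + 4))
           (Seq (copy (B + 3) (B + 2) (B + 4))
                (increment (B + 1))))"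
  have body: "\<exists>\<tau>'. exec ?body \<tau> \<tau>' \<and> ?I k \<tau>'" if I: "?I (Suc k) \<tau>" for k \<tau>
  proof -
    let ?i = "n - Suc k"
    define \<tau>1 where "\<tau>1 = \<tau>(B := k)"
    have t1: "exec (decrement B) \<tau> \<tau>1" unfolding \<tau>1_def using I by (intro exec_decrement) auto
    have "\<forall>r<B. \<tau>1 r = \<sigma> r" using I by (simp add: \<tau>1_def)
    then have map: "map \<tau>1 ((B + 1) # (B + 2) # as') = ?i # v ?i # xs"
      using I map_as' by (simp add: \<tau>1_def)
    have eval: "rec_eval g (?i # v ?i # xs) (v (Suc ?i))" using I by (intro v) auto
    have sub: "set ((B + 1) # (B + 2) # as') \<subseteq> {..<B + 4} - {B + 3}" using as'(6) by auto
    have less: "B + 3 < B + 4" by simp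
    obtain \<tau>2 where t2: "exec (compile g ((B + 1) # (B + 2) # as') (B + 3) (B + 4)) \<tau>1 \<tau>2"
        "\<tau>2 (B + 3) = v (Suc ?i)" "\<And>r. r < B + 4 \<Longrightarrow> r \<noteq> B + 3 \<Longrightarrow> \<tau>2 r = \<tau>1 r"
      using evaluatesD[OF g[OF eval] map less sub] by blast
    define \<tau>3 where "\<tau>3 = \<tau>2(B + 2 := v (Suc ?i), B + 4 := 0)"
    have t3: "exec (copy (B + 3) (B + 2) (B + 4)) \<tau>2 \<tau>3"
      using exec_copy[of "B + 3" "B + 2" "B + 4" \<tau>2] t2(2) by (simp add: \<tau>3_def)
    have t4: "exec (increment (B + 1)) \<tau>3 (\<tau>3(B + 1 := Suc (\<tau>3 (B + 1))))"
      by (rule exec_increment)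
    have "?I k (\<tau>3(B + 1 := Suc (\<tau>3 (B + 1))))"
      using I t2(3) by (auto simp: \<tau>3_def \<tau>1_def Suc_diff_Suc)
    with exec_Seq[OF t1 exec_Seq[OF t2(1) exec_Seq[OF t3 t4]]] show ?thesis by blast
  qed
  have "?I n \<sigma>3" using 3 by (auto simp: \<sigma>1_def \<sigma>2_def)
  then have "\<exists>\<tau>. exec (While B ?body) \<sigma>3 \<tau> \<and> ?I 0 \<tau>"
    by (intro exec_countdown[where I = ?I and n = n]) (use body in auto)
  then obtain \<tau> where 4: "exec (While B ?body) \<sigma>3 \<tau>" "\<tau> (B + 2) = z" "\<forall>r<B. \<tau> r = \<sigma> r"
    using v(3) by auto
  have 5: "exec (copy (B + 2) d (B + 3)) \<tau> (\<tau>(d := z, B + 3 := 0))"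
    using exec_copy[of "B + 2" d "B + 3" \<tau>] 4(2) as(2) by simp
  have "exec (compile (PrimRec f g) as d B) \<sigma> (\<tau>(d := z, B + 3 := 0))"
    unfolding compile.simps as'(1) list.sel
    by (intro exec_Seq[OF 1] exec_Seq[OF 2] exec_Seq[OF 3(1)] exec_Seq[OF 4(1)] 5)
  then show "stores (compile (PrimRec f g) as d B) d z B \<sigma>"
    unfolding stores_def using 4(3) as(2) by (intro exI[of _ "\<tau>(d := z, B + 3 := 0)"]) auto
qed

lemma compile_Minim:
  assumes f: "\<And>xs y. rec_eval f xs y \<Longrightarrow> evaluates (compile f) xs y"
    and z: "rec_eval (Minim f) xs n"
  shows "evaluates (compile (Minim f)) xs n"
proof (rule evaluatesI)
  fix as :: "nat list" and d B :: nat and \<sigma> :: "nat \<Rightarrow> nat"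
  assume as: "map \<sigma> as = xs" "d < B" "set as \<subseteq> {..<B} - {d}"
  have "\<exists>v. \<forall>m\<le>n. rec_eval f (m # xs) (v m) \<and> (v m = 0 \<longleftrightarrow> m = n)"
  proof -
    have "\<forall>m. \<exists>y. m \<le> n \<longrightarrow> rec_eval f (m # xs) y \<and> (y = 0 \<longleftrightarrow> m = n)"
      using z by (metis gr_implies_not0 le_neq_implies_less rec_eval_MinimE)
    then show ?thesis by metis
  qed
  then obtain v where v: "\<And>m. m \<le> n \<Longrightarrow> rec_eval f (m # xs) (v m)" "\<And>m. m \<le> n \<Longrightarrow> v m = 0 \<longleftrightarrow> m = n"
    by blast
  have map_as: "map \<tau> as = xs" if "\<forall>r<B. \<tau> r = \<sigma> r" for \<tau>
    using as that by (auto simp: map_eq_conv subset_iff)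
  let ?f = "compile f (B # as) (B + 1) (B + 2)"
  have eval: "\<exists>\<tau>'. exec ?f \<tau> \<tau>' \<and> \<tau>' B = m \<and> \<tau>' (B + 1) = v m \<and> (\<forall>r<B. \<tau>' r = \<sigma> r)"
    if "m \<le> n" "\<tau> B = m" "\<forall>r<B. \<tau> r = \<sigma> r" for m \<tau>
  proof -
    have map: "map \<tau> (B # as) = m # xs" and sub: "set (B # as) \<subseteq> {..<B + 2} - {B + 1}"
      using that map_as as by auto
    have less: "B + 1 < B + 2" by simp
    note ev = evaluatesD[OF f[OF v(1)[OF that(1)]] map less sub]
    obtain \<tau>' where "exec ?f \<tau> \<tau>'" "\<tau>' (B + 1) = v m" "\<And>r. r < B + 2 \<Longrightarrow> r \<noteq> B + 1 \<Longrightarrow> \<tau>' r = \<tau> r"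
      using ev by blast
    then show ?thesis using that by (intro exI[of _ \<tau>']) auto
  qed
  let ?loop = "While (B + 1) (Seq (increment B) ?f)"
  \<comment> \<open>Induction downwards from \<open>n\<close>: the loop tests \<open>v m\<close>,
    which vanishes exactly at \<open>m = n\<close>.\<close>
  have loop: "\<exists>\<tau>'. exec ?loop \<tau> \<tau>' \<and> \<tau>' B = n \<and> (\<forall>r<B. \<tau>' r = \<sigma> r)"
    if "m \<le> n" "\<tau> B = m" "\<tau> (B + 1) = v m" "\<forall>r<B. \<tau> r = \<sigma> r" for m \<tau>
    using that
  proof (induction arbitrary: \<tau> rule: inc_induct)
    case base
    then show ?case using v(2) exec_While_zero[of \<tau> "B + 1"] by auto
  next
    case (step m)
    define \<tau>1 where "\<tau>1 = \<tau>(B := Suc (\<tau> B))"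
    have 1: "exec (increment B) \<tau> \<tau>1" unfolding \<tau>1_def by (rule exec_increment)
    obtain \<tau>2 where 2: "exec ?f \<tau>1 \<tau>2" "\<tau>2 B = Suc m" "\<tau>2 (B + 1) = v (Suc m)" "\<forall>r<B. \<tau>2 r = \<sigma> r"
      using eval[of "Suc m" \<tau>1] step by (auto simp: \<tau>1_def)
    obtain \<tau>' where "exec ?loop \<tau>2 \<tau>'" "\<tau>' B = n \<and> (\<forall>r<B. \<tau>' r = \<sigma> r)"
      using step.IH[OF 2(2-4)] by blast
    moreover have "\<tau> (B + 1) \<noteq> 0" using step v(2)[of m] by auto
    ultimately show ?case using exec_While_step[OF _ exec_Seq[OF 1 2(1)]] by blast
  qed
  define \<sigma>1 where "\<sigma>1 = \<sigma>(B := 0)"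
  have 1: "exec (clear B) \<sigma> \<sigma>1" unfolding \<sigma>1_def by (rule exec_clear)
  obtain \<sigma>2 where 2: "exec ?f \<sigma>1 \<sigma>2" "\<sigma>2 B = 0" "\<sigma>2 (B + 1) = v 0" "\<forall>r<B. \<sigma>2 r = \<sigma> r"
    using eval[of 0 \<sigma>1] by (auto simp: \<sigma>1_def)
  obtain \<sigma>3 where 3: "exec ?loop \<sigma>2 \<sigma>3" "\<sigma>3 B = n" "\<forall>r<B. \<sigma>3 r = \<sigma> r"
    using loop[of 0 \<sigma>2] 2 by blast
  have 4: "exec (copy B d (B + 1)) \<sigma>3 (\<sigma>3(d := n, B + 1 := 0))"
    using exec_copy[of B d "B + 1" \<sigma>3] 3(2) as(2) by simp
  have "exec (compile (Minim f) as d B) \<sigma> (\<sigma>3(d := n, B + 1 := 0))"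
    unfolding compile.simps
    by (intro exec_Seq[OF 1] exec_Seq[OF 2(1)] exec_Seq[OF 3(1)] 4)
  then show "stores (compile (Minim f) as d B) d n B \<sigma>"
    unfolding stores_def using 3(3) as(2) by (intro exI[of _ "\<sigma>3(d := n, B + 1 := 0)"]) auto
qed

text \<open>Defined values suffice: the assumed algorithm has a value on every valid code, and
  divergence of the final program comes from its explicit search loop alone.\<close>

theorem compile_correct: "rec_eval f xs y \<Longrightarrow> evaluates (compile f) xs y"
proof (induction f arbitrary: xs y)
  case Zero
  then have "y = 0" by (auto elim: rec_eval_ZeroE)
  then show ?case
    using exec_clear by (intro evaluatesI) (fastforce simp: stores_def)
next
  case Succ
  then obtain x where x: "xs = [x]" "y = Suc x" by (auto elim: rec_eval_SuccE)
  show ?case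
  proof (rule evaluatesI)
    fix as :: "nat list" and d B :: nat and \<sigma> :: "nat \<Rightarrow> nat"
    assume as: "map \<sigma> as = xs" "d < B" "set as \<subseteq> {..<B} - {d}"
    then obtain a where a: "as = [a]" "\<sigma> a = x" "a < B" "a \<noteq> d" using x by auto
    let ?\<sigma> = "\<sigma>(d := \<sigma> a, B := 0)"
    have "exec (compile Succ as d B) \<sigma> (?\<sigma>(d := Suc (?\<sigma> d)))"
      using exec_Seq[OF exec_copy[of a d B \<sigma>] exec_increment[of d]] a as(2) by simp
    then show "stores (compile Succ as d B) d y B \<sigma>"
      unfolding stores_def using a x as(2) by (intro exI[of _ "?\<sigma>(d := Suc (?\<sigma> d))"]) auto
  qed
next
  case (Proj i)
  then have i: "i < length xs" "y = xs ! i" by (auto elim: rec_eval_ProjE)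
  show ?case
  proof (rule evaluatesI)
    fix as :: "nat list" and d B :: nat and \<sigma> :: "nat \<Rightarrow> nat"
    assume as: "map \<sigma> as = xs" "d < B" "set as \<subseteq> {..<B} - {d}"
    have "as ! i \<in> {..<B} - {d}" "\<sigma> (as ! i) = y"
      using i as(1) subsetD[OF as(3) nth_mem[of i]] by auto
    then show "stores (compile (Proj i) as d B) d y B \<sigma>"
      unfolding stores_def using exec_copy[of "as ! i" d B \<sigma>] as(2)
      by (intro exI[of _ "\<sigma>(d := \<sigma> (as ! i), B := 0)"]) auto
  qed
next
  case (Comp f gs)
  then obtain ys where ys: "list_all2 (\<lambda>g y. rec_eval g xs y) gs ys" "rec_eval f ys y"
    by (auto elim: rec_eval_CompE)
  have all: "list_all2 (\<lambda>h y. evaluates h xs y) (map compile gs) ys"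
    using ys(1) Comp.IH(2) by (auto simp: list_all2_conv_all_nth)
  show ?case
  proof (rule evaluatesI)
    fix as :: "nat list" and d B :: nat and \<sigma> :: "nat \<Rightarrow> nat"
    assume as: "map \<sigma> as = xs" "d < B" "set as \<subseteq> {..<B} - {d}"
    let ?n = "length gs"
    obtain \<sigma>1 where 1: "exec (compile_all (map compile gs) as B (B + ?n)) \<sigma> \<sigma>1"
        "map \<sigma>1 [B..<B + ?n] = ys" "\<forall>r<B. \<sigma>1 r = \<sigma> r"
      using compile_all[OF all as(1), of B "B + ?n"] as(3) by auto
    have "d < B + ?n" "set [B..<B + ?n] \<subseteq> {..<B + ?n} - {d}" using as(2) by auto
    then obtain \<sigma>2 where 2: "exec (compile f [B..<B + ?n] d (B + ?n)) \<sigma>1 \<sigma>2" "\<sigma>2 d = y"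
        "\<And>r. r < B + ?n \<Longrightarrow> r \<noteq> d \<Longrightarrow> \<sigma>2 r = \<sigma>1 r"
      using evaluatesD[OF Comp.IH(1)[OF ys(2)] 1(2)] by blast
    then show "stores (compile (Comp f gs) as d B) d y B \<sigma>"
      unfolding stores_def using 1(3) exec_Seq[OF 1(1) 2(1)] by (intro exI[of _ \<sigma>2]) auto
  qed
next
  case (PrimRec f g)
  from PrimRec.prems obtain n xs' where "xs = n # xs'"
    by (cases rule: rec_eval.cases) auto
  then show ?case using compile_PrimRec[OF PrimRec.IH] PrimRec.prems by blast
next
  case (Minim f)
  then show ?case using compile_Minim by blast
qed

section \<open>Recursive functions on codes\<close>

lemma rec_eval_Comp1: "rec_eval g xs y \<Longrightarrow> rec_eval f [y] z \<Longrightarrow> rec_eval (Comp f [g]) xs z"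
  by (rule rec_eval.Comp[of _ _ "[y]"]) auto

lemma rec_eval_Comp2:
  "rec_eval g xs y \<Longrightarrow> rec_eval h xs y' \<Longrightarrow> rec_eval f [y, y'] z \<Longrightarrow> rec_eval (Comp f [g, h]) xs z"
  by (rule rec_eval.Comp[of _ _ "[y, y']"]) auto

lemma rec_eval_Proj_0: "rec_eval (Proj 0) (x # xs) x"
  using rec_eval.Proj[of 0 "x # xs"] by simp

lemma rec_eval_Proj_1: "rec_eval (Proj 1) (x # y # xs) y"
  using rec_eval.Proj[of 1 "x # y # xs"] by simp

lemma rec_eval_PrimRecI:
  assumes "rec_eval f xs (v 0)" "\<And>i. i < n \<Longrightarrow> rec_eval g (i # v i # xs) (v (Suc i))"
  shows "rec_eval (PrimRec f g) (n # xs) (v n)"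
  using assms by (induction n) (auto intro: rec_eval.PrimRec_0 rec_eval.PrimRec_Suc)

lemmas rec_eval_basics =
  rec_eval.Zero rec_eval.Succ rec_eval_Proj_0 rec_eval_Proj_1 rec_eval_Proj_1[unfolded One_nat_def]
  rec_eval_Comp1 rec_eval_Comp2

section \<open>Arithmetic, Cantor pairing and its inverse\<close>

definition "recf_add = PrimRec (Proj 0) (Comp Succ [Proj 1])"

lemma recf_add: "rec_eval recf_add [m, n] (m + n)"
  unfolding recf_add_def
  by (rule rec_eval_PrimRecI[where v = "\<lambda>m. m + n", simplified])
    (auto intro!: rec_eval_basics)

definition "recf_pred = PrimRec Zero (Proj 0)"

lemma recf_pred: "rec_eval recf_pred [n] (n - 1)"
  unfolding recf_pred_def
  by (rule rec_eval_PrimRecI[where v = "\<lambda>n. n - 1"]) (auto intro!: rec_eval_basics)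

text \<open>The arguments are swapped, since recursion is on the first argument.\<close>

definition "recf_sub = PrimRec (Proj 0) (Comp recf_pred [Proj 1])"

lemma recf_sub: "rec_eval recf_sub [m, n] (n - m)"
  unfolding recf_sub_def
proof (rule rec_eval_PrimRecI[where v = "\<lambda>m. n - m"])
  fix i
  show "rec_eval (Comp recf_pred [Proj 1]) [i, n - i, n] (n - Suc i)"
    using recf_pred[of "n - i"] by (auto intro!: rec_eval_basics)
qed (auto intro: rec_eval_basics)

definition "recf_triangle = PrimRec Zero (Comp recf_add [Comp Succ [Proj 0], Proj 1])"

lemma recf_triangle: "rec_eval recf_triangle [n] (triangle n)"
  unfolding recf_triangle_def
proof (rule rec_eval_PrimRecI)
  fix i
  show "rec_eval (Comp recf_add [Comp Succ [Proj 0], Proj 1]) [i, triangle i] (triangle (Suc i))"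
    using recf_add[of "Suc i" "triangle i"] by (auto intro!: rec_eval_basics simp: add.commute)
qed (auto intro: rec_eval_basics)

definition "recf_pair = Comp recf_add [Comp recf_triangle [recf_add], Proj 0]"

lemma recf_pair: "rec_eval recf_pair [m, n] (prod_encode (m, n))"
  using recf_triangle[of "m + n"] recf_add[of m n] recf_add[of "triangle (m + n)" m]
  unfolding recf_pair_def prod_encode_def by (auto intro!: rec_eval_basics)

text \<open>Subtraction is truncated, so the summand is 1 when \<open>Suc n\<close> reaches the next
  triangular number and 0 otherwise. This avoids an unbounded search for the root.\<close>

primrec triangle_root :: "nat \<Rightarrow> nat" where
  "triangle_root 0 = 0"
| "triangle_root (Suc n) =
     triangle_root n + (1 - (triangle (Suc (triangle_root n)) - Suc n))"

lemma triangle_root: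
  "triangle (triangle_root n) \<le> n \<and> n < triangle (Suc (triangle_root n))"
proof (induction n)
  case (Suc n)
  then show ?case
    by (cases "triangle (Suc (triangle_root n)) \<le> Suc n") auto
qed simp

definition "recf_root = PrimRec Zero (Comp recf_add [Proj 1,
  Comp recf_sub [Comp recf_sub [Comp Succ [Proj 0], Comp recf_triangle [Comp Succ [Proj 1]]],
    Comp Succ [Zero]]])"

lemma recf_root: "rec_eval recf_root [n] (triangle_root n)"
  unfolding recf_root_def
proof (rule rec_eval_PrimRecI)
  fix i
  let ?s = "triangle_root i"
  show "rec_eval (Comp recf_add [Proj 1,
      Comp recf_sub [Comp recf_sub [Comp Succ [Proj 0], Comp recf_triangle [Comp Succ [Proj 1]]],
      Comp Succ [Zero]]]) [i, ?s] (triangle_root (Suc i))"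
    unfolding triangle_root.simps
    by (rule rec_eval_basics recf_add recf_sub recf_triangle | simp only: One_nat_def)+
qed (auto intro: rec_eval_basics)

text \<open>Since \<open>prod_encode (a, b) = triangle (a + b) + a\<close> and a \<le> a + b, the
  root recovers a + b and the remainder recovers a.\<close>

lemma prod_decode_root:
  "prod_decode n = (n - triangle (triangle_root n), triangle_root n - (n - triangle (triangle_root n)))"
proof -
  let ?s = "triangle_root n"
  have "n - triangle ?s \<le> ?s" "triangle ?s \<le> n" using triangle_root[of n] by auto
  then have "prod_encode (n - triangle ?s, ?s - (n - triangle ?s)) = n"
    by (simp add: prod_encode_def)
  then show ?thesis by (metis prod_encode_inverse)
qed

definition "recf_fst = Comp recf_sub [Comp recf_triangle [recf_root], Proj 0]"
definition "recf_snd = Comp recf_sub [recf_fst, recf_root]"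

lemma recf_fst: "rec_eval recf_fst [n] (fst (prod_decode n))"
  unfolding recf_fst_def prod_decode_root fst_conv
  by (rule rec_eval_basics recf_sub recf_triangle recf_root)+

lemma recf_snd: "rec_eval recf_snd [n] (snd (prod_decode n))"
proof -
  have "rec_eval recf_fst [n] (n - triangle (triangle_root n))"
    using recf_fst[of n] by (simp add: prod_decode_root)
  then show ?thesis
    unfolding recf_snd_def prod_decode_root snd_conv
    by (rule rec_eval_Comp2[OF _ recf_root recf_sub])
qed

text \<open>The empty polynomial has code 0, so these are the codes of lists of \<open>k\<close>
  zero polynomials, which describe the whole space.\<close>

definition "recf_zeros = PrimRec Zero (Comp Succ [Comp recf_pair [Zero, Proj 1]])"

lemma recf_zeros: "rec_eval recf_zeros [k] (list_encode (replicate k 0))"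
  unfolding recf_zeros_def
proof (rule rec_eval_PrimRecI[where v = "\<lambda>k. list_encode (replicate k 0)"])
  fix i
  let ?v = "list_encode (replicate i 0)"
  show "rec_eval (Comp Succ [Comp recf_pair [Zero, Proj 1]]) [i, ?v]
      (list_encode (replicate (Suc i) 0))"
    unfolding replicate_Suc list_encode.simps
    by (rule rec_eval_basics recf_pair)+
qed (auto intro: rec_eval_basics)

text \<open>One of two opposite truncated differences is always 0, so their sum is the distance and
  vanishes only for equal numbers.\<close>

definition "recf_zeros_dist =
  Comp recf_add [Comp recf_sub [Proj 1, Comp recf_zeros [Proj 0]],
    Comp recf_sub [Comp recf_zeros [Proj 0], Proj 1]]"

lemma recf_zeros_dist:
  "rec_eval recf_zeros_dist [k, v]
     ((list_encode (replicate k 0) - v) + (v - list_encode (replicate k 0)))"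
  unfolding recf_zeros_dist_def
  by (rule rec_eval_basics recf_add recf_sub recf_zeros)+

text \<open>Reads the entry of location 1, the one at which the strongest invariant tells halting
  from divergence.\<close>

definition "recf_second = Comp recf_fst [Comp recf_pred [Comp recf_snd [recf_pred]]]"

lemma recf_second: "rec_eval recf_second [list_encode (x # y # zs)] y"
proof -
  let ?b = "list_encode (y # zs)"
  have "rec_eval recf_pred [list_encode (x # y # zs)] (prod_encode (x, ?b))"
    using recf_pred[of "list_encode (x # y # zs)"] by simp
  moreover have "rec_eval recf_snd [prod_encode (x, ?b)] ?b"
    using recf_snd[of "prod_encode (x, ?b)"] by simp
  moreover have "rec_eval recf_pred [?b] (prod_encode (y, list_encode zs))"
    using recf_pred[of ?b] by simp
  moreover have "rec_eval recf_fst [prod_encode (y, list_encode zs)] y"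
    using recf_fst[of "prod_encode (y, list_encode zs)"] by simp
  ultimately show ?thesis
    unfolding recf_second_def by (meson rec_eval_Comp1)
qed

text \<open>Pairs without the \<open>Suc\<close> of \<open>list_encode\<close>: a tuple of known
  length is read by projections only.\<close>

primrec tuple_encode :: "nat list \<Rightarrow> nat" where
  "tuple_encode [] = 0"
| "tuple_encode (x # xs) = prod_encode (x, tuple_encode xs)"

primrec recf_component :: "nat \<Rightarrow> recf" where
  "recf_component 0 = recf_fst"
| "recf_component (Suc i) = Comp (recf_component i) [recf_snd]"

lemma recf_component: "i < length xs \<Longrightarrow> rec_eval (recf_component i) [tuple_encode xs] (xs ! i)"
proof (induction xs arbitrary: i)
  case (Cons x xs)
  have "rec_eval recf_fst [tuple_encode (x # xs)] x"
    using recf_fst[of "tuple_encode (x # xs)"] by simp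
  moreover have "rec_eval recf_snd [tuple_encode (x # xs)] (tuple_encode xs)"
    using recf_snd[of "tuple_encode (x # xs)"] by simp
  ultimately show ?case
    using Cons by (cases i) (auto intro: rec_eval_Comp1)
qed simp

section \<open>Codes of polynomials\<close>

definition num :: "int \<Rightarrow> alg_code" where
  "num n = ([:- n, 1:], of_int (n - 1), of_int (n + 1))"

lemma isolates_num_iff: "isolates (num n) x \<longleftrightarrow> x = of_int n"
  by (auto simp: isolates_def num_def map_poly_pCons of_rat_diff of_rat_add)

lemma valid_alg_num [simp]: "valid_alg (num n)"
  by (auto simp: valid_alg_def isolates_num_iff)

lemma alg_val_num [simp]: "alg_val (num n) = of_int n"
  by (simp add: alg_val_def isolates_num_iff)

lemma monomial_eval_nth:
  assumes "length es = d"
  shows "monomial_eval (Poly_Mapping.nth es) x = (\<Prod>i<d. (x $ i) ^ (es ! i))"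
proof -
  have "Poly_Mapping.keys (Poly_Mapping.nth es) \<subseteq> {..<d}"
    using assms by (auto simp: in_set_enumerate_eq)
  then have "monomial_eval (Poly_Mapping.nth es) x = (\<Prod>i<d. (x $ i) ^ nth_default 0 es i)"
    by (subst monomial_eval_superset[of "{..<d}"]) auto
  also have "\<dots> = (\<Prod>i<d. (x $ i) ^ (es ! i))"
    using assms by (intro prod.cong) (auto simp: nth_default_def)
  finally show ?thesis .
qed

lemma mpoly_eval_mpoly_of:
  assumes "\<forall>(c, es)\<in>set ts. length es = d"
  shows "mpoly_eval (mpoly_of ts) x = (\<Sum>(c, es)\<leftarrow>ts. alg_val c * (\<Prod>i<d. (x $ i) ^ (es ! i)))"
  using assms
  by (induction ts) (auto simp: mpoly_eval_add mpoly_eval_single monomial_eval_nth)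

definition square_free :: "nat \<Rightarrow> nat set \<Rightarrow> nat list" where
  "square_free d S = map (\<lambda>i. if i \<in> S then 1 else 0) [0..<d]"

lemma length_square_free [simp]: "length (square_free d S) = d"
  by (simp add: square_free_def)

lemma prod_square_free:
  fixes x :: "real vec"
  assumes "S \<subseteq> {..<d}"
  shows "(\<Prod>i<d. (x $ i) ^ (square_free d S ! i)) = (\<Prod>i\<in>S. x $ i)"
proof -
  have "(\<Prod>i<d. (x $ i) ^ (square_free d S ! i)) = (\<Prod>i<d. if i \<in> S then x $ i else 1)"
    by (intro prod.cong) (auto simp: square_free_def)
  also have "\<dots> = (\<Prod>i\<in>{..<d} \<inter> S. x $ i)" by (rule prod.inter_restrict[symmetric]) simp
  also have "{..<d} \<inter> S = S" using assms by blast
  finally show ?thesis .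
qed

lemma square_free_eq_iff:
  "S \<subseteq> {..<d} \<Longrightarrow> S' \<subseteq> {..<d} \<Longrightarrow> square_free d S = square_free d S' \<longleftrightarrow> S = S'"
proof -
  have "{i. i < d \<and> square_free d S ! i = 1} = S" if "S \<subseteq> {..<d}" for S
    using that by (auto simp: square_free_def split: if_splits)
  then show "S \<subseteq> {..<d} \<Longrightarrow> S' \<subseteq> {..<d} \<Longrightarrow> square_free d S = square_free d S' \<longleftrightarrow> S = S'"
    by metis
qed

definition coord_poly :: "nat \<Rightarrow> nat \<Rightarrow> nat \<Rightarrow> mpoly_code" where
  "coord_poly d i n = [(num 1, square_free d {i}), (num (- int n), square_free d {})]"

text \<open>Rabinowitsch's polynomial y * (r - 1) - 1 stands for the disequality r \<noteq> 1, with
  the clock as the auxiliary variable.\<close>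

definition not_one_poly :: "nat \<Rightarrow> nat \<Rightarrow> mpoly_code" where
  "not_one_poly d r =
     [(num 1, square_free d {0, Suc r}), (num (- 1), square_free d {0}), (num (- 1), square_free d {})]"

text \<open>Its zero set is empty: the initial set of all locations but the first.\<close>

definition unit_poly :: "nat \<Rightarrow> mpoly_code" where
  "unit_poly d = [(num 1, square_free d {})]"

text \<open>With the clock at 2 this sets register 0 to \<open>2 ^ e\<close>. As an exponent,
  \<open>e\<close> enters the code as a bare number, whereas a coefficient \<open>2 ^ e\<close>
  would come wrapped in a polynomial and an isolating interval.\<close>

definition power_poly :: "nat \<Rightarrow> nat \<Rightarrow> mpoly_code" where
  "power_poly d e = [(num (- 1), e # replicate (d - 1) 0), (num 1, square_free d {1})]"

lemma valid_mpolys: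
  "i < d \<Longrightarrow> n > 0 \<Longrightarrow> valid_mpoly d (coord_poly d i n)"
  "Suc r < d \<Longrightarrow> valid_mpoly d (not_one_poly d r)"
  "valid_mpoly d (unit_poly d)"
  by (auto simp: valid_mpoly_def coord_poly_def not_one_poly_def unit_poly_def square_free_eq_iff)

lemma valid_power_poly: "d > 1 \<Longrightarrow> valid_mpoly d (power_poly d e)"
proof -
  assume d: "d > 1"
  then have "square_free d {1} ! 1 \<noteq> (e # replicate (d - 1) 0) ! 1"
    by (simp add: square_free_def)
  then have "e # replicate (d - 1) 0 \<noteq> square_free d {1}" by metis
  then show ?thesis using d by (auto simp: valid_mpoly_def power_poly_def)
qed

lemma eval_coord_poly: "i < d \<Longrightarrow> mpoly_eval (mpoly_of (coord_poly d i n)) x = x $ i - real n"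
  by (subst mpoly_eval_mpoly_of[of _ d]) (auto simp: coord_poly_def prod_square_free)

lemma eval_not_one_poly:
  "Suc r < d \<Longrightarrow> mpoly_eval (mpoly_of (not_one_poly d r)) x = x $ 0 * (x $ Suc r - 1) - 1"
  by (subst mpoly_eval_mpoly_of[of _ d])
    (auto simp: not_one_poly_def prod_square_free algebra_simps)

lemma eval_unit_poly: "mpoly_eval (mpoly_of (unit_poly d)) x = 1"
  by (subst mpoly_eval_mpoly_of[of _ d]) (auto simp: unit_poly_def prod_square_free)

lemma eval_power_poly:
  assumes "d > 1"
  shows "mpoly_eval (mpoly_of (power_poly d e)) x = x $ 1 - (x $ 0) ^ e"
proof -
  obtain d' where d: "d = Suc d'" using assms by (cases d) auto
  have "(\<Prod>i<d. (x $ i) ^ ((e # replicate (d - 1) 0) ! i)) = (x $ 0) ^ e"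
    unfolding d by (subst prod.lessThan_Suc_shift) simp
  then show ?thesis
    using assms by (subst mpoly_eval_mpoly_of[of _ d]) (auto simp: power_poly_def prod_square_free)
qed

lemma set_of_Nil [simp]: "set_of d [] = carrier_vec d"
  by (auto simp: set_of_def zero_set_def)

lemma set_of_Cons: "set_of d (p # ps) = {x \<in> set_of d ps. mpoly_eval (mpoly_of p) x = 0}"
  by (auto simp: set_of_def zero_set_def)

section \<open>The switching system of a program\<close>

text \<open>Coordinate \<open>0\<close> is a clock \<open>y\<close> and coordinate \<open>Suc r\<close> is the register \<open>r\<close>. The location \<open>Ctl c\<close>
  stands for the program point \<open>c\<close>, and its flow leaves \<open>y\<close> free. In \<open>Mid r b c\<close> the register \<open>r\<close> and \<open>y\<close>
  grow at the same rate, so that the guards on \<open>y\<close> at entry and exit force \<open>r\<close> to double or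
  halve. The locations \<open>Blow j\<close> forget everything except for register \<open>2\<close>.\<close>

datatype loc = Ctl com | Mid nat bool com | Blow nat

fun flow_coords :: "loc \<Rightarrow> nat set" where
  "flow_coords (Ctl c) = {0}"
| "flow_coords (Mid r b c) = {0, Suc r}"
| "flow_coords (Blow j) = {j} - {3}"

fun act_regs :: "act \<Rightarrow> nat set" where
  "act_regs Tau = {}"
| "act_regs (Scale r b) = {r}"
| "act_regs (Is_one r) = {r}"
| "act_regs (Not_one r) = {r}"

text \<open>All registers in use fit into the coordinates 1 to \<open>R\<close>, and register 2,
  whose growth is observed, is among them.\<close>

locale program =
  fixes prog :: com and R :: nat
  assumes regs: "c \<in> set (residuals prog) \<Longrightarrow> (l, c') \<in> set (succs c) \<Longrightarrow> act_regs l \<subseteq> {..<R}"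
    and R: "2 < R"
begin

abbreviation d :: nat where "d \<equiv> Suc R"

definition transitions :: "(com \<times> act \<times> com) list" where
  "transitions = concat (map (\<lambda>c. map (\<lambda>(l, c'). (c, l, c')) (succs c)) (residuals prog))"

lemma in_transitions:
  "(c, l, c') \<in> set transitions \<longleftrightarrow> c \<in> set (residuals prog) \<and> (l, c') \<in> set (succs c)"
  by (auto simp: transitions_def)

fun trans_edges :: "com \<times> act \<times> com \<Rightarrow> (loc \<times> set_code \<times> loc) list" where
  "trans_edges (c, Scale r b, c') =
     [(Ctl c, [coord_poly d 0 (clock_in b)], Mid r b c'),
      (Mid r b c', [coord_poly d 0 (clock_out b)], Ctl c')]"
| "trans_edges (c, Tau, c') = [(Ctl c, [], Ctl c')]"
| "trans_edges (c, Is_one r, c') = [(Ctl c, [coord_poly d (Suc r) 1], Ctl c')]"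
| "trans_edges (c, Not_one r, c') = [(Ctl c, [not_one_poly d r], Ctl c')]"

fun trans_locs :: "com \<times> act \<times> com \<Rightarrow> loc list" where
  "trans_locs (c, Scale r b, c') = [Mid r b c']"
| "trans_locs _ = []"

text \<open>The unguarded edges between all \<open>Blow\<close> locations make every invariant the
  same set there, so that the freedoms of the single coordinates add up.\<close>

definition loc_edges :: "(loc \<times> set_code \<times> loc) list" where
  "loc_edges = concat (map trans_edges transitions) @
     concat (map (\<lambda>c. map (\<lambda>j. (Ctl c, [], Blow j)) [0..<d]) (residuals prog)) @
     concat (map (\<lambda>i. map (\<lambda>j. (Blow i, [], Blow j)) [0..<d]) [0..<d])"

text \<open>The two distinguished locations come first, so that their indices 0 and 1 do not depend
  on the program. A later occurrence of the same entry is a location without edges and without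
  initial states, as \<open>idx\<close> picks the first one.\<close>

definition locations :: "loc list" where
  "locations = Ctl prog # Blow 0 # map Ctl (residuals prog) @
     concat (map trans_locs transitions) @ map Blow [0..<d]"

definition idx :: "loc \<Rightarrow> nat" where
  "idx l = (LEAST i. i < length locations \<and> locations ! i = l)"

lemma idx: "l \<in> set locations \<Longrightarrow> idx l < length locations \<and> locations ! idx l = l"
  unfolding idx_def by (rule LeastI_ex) (auto simp: in_set_conv_nth)

lemma idx_prog: "idx (Ctl prog) = 0"
  unfolding idx_def by (rule Least_equality) (auto simp: locations_def)

lemma idx_Blow_0: "idx (Blow 0) = 1"
  unfolding idx_def
proof (rule Least_equality)
  fix i assume "i < length locations \<and> locations ! i = Blow 0"
  then show "1 \<le> i" by (cases i) (auto simp: locations_def)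
qed (auto simp: locations_def)

lemma in_locations:
  "c \<in> set (residuals prog) \<Longrightarrow> Ctl c \<in> set locations"
  "j < d \<Longrightarrow> Blow j \<in> set locations"
  "(c, Scale r b, c') \<in> set transitions \<Longrightarrow> Mid r b c' \<in> set locations"
  by (force simp: locations_def)+

lemma in_loc_edges:
  assumes "(a, G, b) \<in> set loc_edges"
  obtains
    (Enter) c r k c' where "(c, Scale r k, c') \<in> set transitions" "a = Ctl c"
      "G = [coord_poly d 0 (clock_in k)]" "b = Mid r k c'"
  | (Leave) c r k c' where "(c, Scale r k, c') \<in> set transitions" "a = Mid r k c'"
      "G = [coord_poly d 0 (clock_out k)]" "b = Ctl c'"
  | (Tau) c c' where "(c, Tau, c') \<in> set transitions" "a = Ctl c" "G = []" "b = Ctl c'"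
  | (Is_one) c r c' where "(c, Is_one r, c') \<in> set transitions" "a = Ctl c"
      "G = [coord_poly d (Suc r) 1]" "b = Ctl c'"
  | (Not_one) c r c' where "(c, Not_one r, c') \<in> set transitions" "a = Ctl c"
      "G = [not_one_poly d r]" "b = Ctl c'"
  | (Forget) c j where "c \<in> set (residuals prog)" "j < d" "a = Ctl c" "G = []" "b = Blow j"
  | (Blow) i j where "i < d" "j < d" "a = Blow i" "G = []" "b = Blow j"
proof -
  consider (t) t where "t \<in> set transitions" "(a, G, b) \<in> set (trans_edges t)"
    | (f) c j where "c \<in> set (residuals prog)" "j < d" "a = Ctl c" "G = []" "b = Blow j"
    | (b) i j where "i < d" "j < d" "a = Blow i" "G = []" "b = Blow j"
    using assms by (auto simp: loc_edges_def simp del: upt_Suc)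
  then show thesis
  proof cases
    case t
    then show thesis using that(1-5) by (cases t rule: trans_edges.cases) auto
  qed (use that in blast)+
qed

lemma trans_edges_subset: "t \<in> set transitions \<Longrightarrow> set (trans_edges t) \<subseteq> set loc_edges"
  by (auto simp: loc_edges_def)

lemma blow_edges:
  "c \<in> set (residuals prog) \<Longrightarrow> j < d \<Longrightarrow> (Ctl c, [], Blow j) \<in> set loc_edges"
  "i < d \<Longrightarrow> j < d \<Longrightarrow> (Blow i, [], Blow j) \<in> set loc_edges"
  by (auto simp: loc_edges_def image_iff simp del: upt_Suc)

lemma transition_locs:
  "(c, l, c') \<in> set transitions \<Longrightarrow> Ctl c \<in> set locations \<and> Ctl c' \<in> set locations"
  using in_locations(1) residuals_succs by (auto simp: in_transitions)

lemma transition_regs: "(c, l, c') \<in> set transitions \<Longrightarrow> act_regs l \<subseteq> {..<R}"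
  using regs by (auto simp: in_transitions)

lemma loc_edges_locations:
  assumes "(a, G, b) \<in> set loc_edges"
  shows "a \<in> set locations \<and> b \<in> set locations \<and> valid_set d G"
  using assms
proof (cases rule: in_loc_edges)
  case Enter
  then show ?thesis
    using transition_locs in_locations(3) valid_mpolys(1)[of 0 d]
    by (auto simp: valid_set_def clock_in_def)
next
  case Leave
  then show ?thesis
    using transition_locs in_locations(3) valid_mpolys(1)[of 0 d]
    by (auto simp: valid_set_def clock_out_def)
next
  case Tau
  then show ?thesis using transition_locs by (auto simp: valid_set_def)
next
  case Is_one
  then show ?thesis
    using transition_locs transition_regs[OF Is_one(1)] by (auto simp: valid_set_def valid_mpolys)
next
  case Not_one
  then show ?thesis
    using transition_locs transition_regs[OF Not_one(1)] by (auto simp: valid_set_def valid_mpolys)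
next
  case Forget
  then show ?thesis using in_locations by (auto simp: valid_set_def)
next
  case Blow
  then show ?thesis using in_locations by (auto simp: valid_set_def)
qed

definition loc_rows :: "loc \<Rightarrow> alg_code list list" where
  "loc_rows l =
     map (\<lambda>i. map (\<lambda>j. if i = j \<and> i \<in> flow_coords l then num 1 else num 0) [0..<d]) [0..<d]"

lemma loc_rows: "mat_of_rows_list d (map (map alg_val) (loc_rows l)) = scaling_mat d (flow_coords l)"
  by (auto simp: mat_of_rows_list_def loc_rows_def scaling_mat_def intro!: eq_matI simp del: upt_Suc)

definition start_rest :: set_code where
  "start_rest = coord_poly d 0 2 # map (\<lambda>i. coord_poly d i 1) [2..<d]"

text \<open>The number \<open>e\<close> is the input of the program: register \<open>0\<close> starts with \<open>y ^ e = 2 ^ e\<close>.\<close>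

definition system_code :: "nat \<Rightarrow> system_code" where
  "system_code e =
     (d, (loc_rows (Ctl prog), power_poly d e # start_rest) #
         map (\<lambda>l. (loc_rows l, [unit_poly d])) (tl locations),
      map (\<lambda>(a, G, b). (idx a, G, idx b)) loc_edges)"

lemma valid_system_code: "valid_system (system_code e)"
proof -
  have "valid_set d (power_poly d e # start_rest)"
    using R by (auto simp: valid_set_def start_rest_def intro!: valid_mpolys valid_power_poly)
  moreover have "length (loc_rows l) = d" "\<forall>row\<in>set (loc_rows l). length row = d \<and> (\<forall>c\<in>set row. valid_alg c)"
    for l
    by (auto simp: loc_rows_def)
  moreover have "valid_set d [unit_poly d]" by (simp add: valid_set_def valid_mpolys)
  moreover have "length locations = Suc (length (tl locations))"
    by (simp add: locations_def)
  ultimately show ?thesis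
    using loc_edges_locations idx
    by (fastforce simp: valid_system_def system_code_def)
qed

abbreviation system :: "nat \<Rightarrow> switching_system" where
  "system e \<equiv> system_of (system_code e)"

definition start_point_set :: "nat \<Rightarrow> real vec set" where
  "start_point_set e =
     {x \<in> carrier_vec d. x $ 0 = 2 \<and> x $ 1 = 2 ^ e \<and> (\<forall>i\<in>{2..<d}. x $ i = 1)}"

lemma set_of_start: "set_of d (power_poly d e # start_rest) = start_point_set e"
proof -
  have "set_of d (map (\<lambda>i. coord_poly d i 1) [2..<d]) = {x \<in> carrier_vec d. \<forall>i\<in>{2..<d}. x $ i = 1}"
    by (auto simp: set_of_def zero_set_def eval_coord_poly simp del: upt_Suc)
  then show ?thesis
    using R by (auto simp: set_of_Cons start_rest_def eval_coord_poly eval_power_poly start_point_set_def)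
qed

lemma system_sel:
  "dim (system e) = d" "locs (system e) = {..<length locations}"
  "q < length locations \<Longrightarrow> dyn (system e) q = scaling_mat d (flow_coords (locations ! q))"
  "q < length locations \<Longrightarrow> start (system e) q = (if q = 0 then start_point_set e else {})"
  "edges (system e) = (\<lambda>(a, G, b). (idx a, set_of d G, idx b)) ` set loc_edges"
proof -
  obtain rest where locations: "locations = Ctl prog # rest" by (simp add: locations_def)
  have empty: "set_of d [unit_poly d] = {}"
    by (auto simp: set_of_Cons eval_unit_poly)
  show "dim (system e) = d" "locs (system e) = {..<length locations}"
    by (simp_all add: system_of_def system_code_def locations)
  show "dyn (system e) q = scaling_mat d (flow_coords (locations ! q))" if "q < length locations"
    using that by (cases q) (simp_all add: system_of_def system_code_def loc_rows locations)
  show "start (system e) q = (if q = 0 then start_point_set e else {})" if "q < length locations"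
    using that by (cases q) (simp_all add: system_of_def system_code_def set_of_start empty locations)
  show "edges (system e) = (\<lambda>(a, G, b). (idx a, set_of d G, idx b)) ` set loc_edges"
    by (simp add: system_of_def system_code_def image_image case_prod_unfold)
qed

lemma invariant_iff:
  "algebraic_inductive_invariant (system e) V \<longleftrightarrow>
     (\<forall>q<length locations. algebraic_set d (V q)) \<and>
     start_point_set e \<subseteq> V 0 \<and>
     (\<forall>q<length locations. \<forall>t\<ge>0. \<forall>x\<in>V q.
        mat_exp (t \<cdot>\<^sub>m scaling_mat d (flow_coords (locations ! q))) *\<^sub>v x \<in> V q) \<and>
     (\<forall>(a, G, b)\<in>set loc_edges. V (idx a) \<inter> set_of d G \<subseteq> V (idx b))"
proof -
  have "0 < length locations" by (simp add: locations_def)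
  then have "(\<forall>q\<in>locs (system e). start (system e) q \<subseteq> V q) \<longleftrightarrow> start_point_set e \<subseteq> V 0"
    by (auto simp: system_sel)
  moreover have "(\<forall>(p, G, q)\<in>edges (system e). V p \<inter> G \<subseteq> V q) \<longleftrightarrow>
      (\<forall>(a, G, b)\<in>set loc_edges. V (idx a) \<inter> set_of d G \<subseteq> V (idx b))"
    by (fastforce simp: system_sel)
  moreover have "(\<forall>q\<in>locs (system e). \<forall>t\<ge>0. (\<lambda>x. mat_exp (t \<cdot>\<^sub>m dyn (system e) q) *\<^sub>v x) ` V q \<subseteq> V q) \<longleftrightarrow>
     (\<forall>q<length locations. \<forall>t\<ge>0. \<forall>x\<in>V q.
        mat_exp (t \<cdot>\<^sub>m scaling_mat d (flow_coords (locations ! q))) *\<^sub>v x \<in> V q)"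
    by (simp add: system_sel image_subset_iff Ball_def)
  ultimately show ?thesis
    unfolding algebraic_inductive_invariant_def by (simp add: system_sel Ball_def)
qed

definition input :: "nat \<Rightarrow> nat \<Rightarrow> nat" where
  "input e r = (if r = 0 then e else 0)"

definition point :: "real \<Rightarrow> (nat \<Rightarrow> real) \<Rightarrow> real vec" where
  "point y s = vec d (\<lambda>i. case i of 0 \<Rightarrow> y | Suc r \<Rightarrow> s r)"

lemma point_sel [simp]:
  "point y s \<in> carrier_vec d" "point y s $ 0 = y" "r < R \<Longrightarrow> point y s $ Suc r = s r"
  by (simp_all add: point_def)

lemma scale_point_Ctl: "scale d (flow_coords (Ctl c)) u (point y s) = point (u * y) s"
  by (auto simp: scale_def point_def split: nat.splits intro!: eq_vecI)

lemma scale_point_Mid: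
  "scale d (flow_coords (Mid r b c)) u (point y s) = point (u * y) (s(r := u * s r))"
  by (auto simp: scale_def point_def split: nat.splits intro!: eq_vecI)

abbreviation reachable :: "nat \<Rightarrow> com \<Rightarrow> (nat \<Rightarrow> real) \<Rightarrow> bool" where
  "reachable e c s \<equiv> steps (prog, repr (input e)) (c, s)"

lemma reachable_transition:
  assumes "reachable e c s" "(l, c') \<in> set (succs c)"
  shows "(c, l, c') \<in> set transitions"
  using assms steps_residuals by (auto simp: in_transitions)

section \<open>Every invariant contains the encoded run\<close>

context
  fixes e V
  assumes V: "algebraic_inductive_invariant (system e) V"
begin

lemma V_algebraic: "l \<in> set locations \<Longrightarrow> algebraic_set d (V (idx l))"
  using V idx by (auto simp: invariant_iff)

lemma V_edge: "(a, G, b) \<in> set loc_edges \<Longrightarrow> x \<in> V (idx a) \<Longrightarrow> x \<in> set_of d G \<Longrightarrow> x \<in> V (idx b)"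
  using V by (fastforce simp: invariant_iff)

lemma V_scale:
  assumes "l \<in> set locations" "x \<in> V (idx l)"
  shows "scale d (flow_coords l) u x \<in> V (idx l)"
proof (rule scale_in_algebraic_set[OF V_algebraic[OF assms(1)] assms(2)])
  fix t :: real and x
  assume "0 \<le> t" "x \<in> V (idx l)"
  moreover have "idx l < length locations" "locations ! idx l = l" using idx assms(1) by auto
  ultimately show "mat_exp (t \<cdot>\<^sub>m scaling_mat d (flow_coords l)) *\<^sub>v x \<in> V (idx l)"
    using V unfolding invariant_iff by metis
qed

lemma V_transition: "t \<in> set transitions \<Longrightarrow> (a, G, b) \<in> set (trans_edges t) \<Longrightarrow>
    x \<in> V (idx a) \<Longrightarrow> x \<in> set_of d G \<Longrightarrow> x \<in> V (idx b)"
  using trans_edges_subset V_edge by blast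

text \<open>Any target \<open>y'\<close> can be reached, even 0, but a clock at 0 could not be moved
  again by scaling.\<close>

lemma V_Ctl_clock:
  assumes "Ctl c \<in> set locations" "point y s \<in> V (idx (Ctl c))" "y \<noteq> 0"
  shows "point y' s \<in> V (idx (Ctl c))"
  using V_scale[OF assms(1,2), of "y' / y"] assms(3) by (simp only: scale_point_Ctl) simp

text \<open>Proved for all clock values at once, because each guard asks for its own:
  \<open>clock_in b\<close> on entering a \<open>Mid\<close> location, 1 / (r - 1) at a
  disequality.\<close>

lemma V_reachable: "reachable e c s \<Longrightarrow> point y s \<in> V (idx (Ctl c))"
proof (induction "(c, s)" arbitrary: c s y rule: rtranclp_induct)
  case base
  have "point 2 (repr (input e)) \<in> start_point_set e"
  proof -
    have "point 2 (repr (input e)) $ i = 1" if "i \<in> {2..<d}" for i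
      using that by (cases i) (auto simp: repr_def input_def)
    then show ?thesis using R point_sel(3)[of 0 2 "repr (input e)"]
      by (auto simp: start_point_set_def repr_def input_def)
  qed
  then have "point 2 (repr (input e)) \<in> V (idx (Ctl prog))"
    using V by (auto simp: invariant_iff idx_prog)
  then show ?case
    by (rule V_Ctl_clock[OF in_locations(1)[OF self_in_residuals]]) simp
next
  case (step z)
  obtain c0 s0 where z: "z = (c0, s0)" by (cases z)
  have IH: "point y s0 \<in> V (idx (Ctl c0))" for y using step z by blast
  from step(2) z obtain l where l: "(l, c) \<in> set (succs c0)" "enabled l s0" "s = effect l s0"
    by (auto elim: step.cases)
  have t: "(c0, l, c) \<in> set transitions" using reachable_transition[OF _ l(1)] step(1) z by blast
  have locs: "Ctl c \<in> set locations" using transition_locs[OF t] by simp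
  show ?case
  proof (cases l)
    case Tau
    then show ?thesis using V_transition[OF t, of "Ctl c0" "[]" "Ctl c"] IH l(3) by simp
  next
    case (Scale r b)
    then have r: "r < R" using transition_regs[OF t] by simp
    let ?in = "real (clock_in b)" and ?out = "real (clock_out b)"
    let ?m = "Mid r b c"
    have Mid: "?m \<in> set locations" using in_locations(3) t Scale by blast
    have "point ?in s0 \<in> V (idx ?m)"
      using V_transition[OF t, of "Ctl c0" "[coord_poly d 0 (clock_in b)]" ?m] IH Scale
      by (simp add: set_of_Cons eval_coord_poly)
    \<comment> \<open>The factor is 2 or 1/2; the latter lies in the past of the flow and is
      available by closedness only.\<close>
    from V_scale[OF Mid this, of "?out / ?in"]
    have "point ?out (s0(r := ?out / ?in * s0 r)) \<in> V (idx ?m)"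
      by (simp only: scale_point_Mid) (simp add: clock_in_def)
    then have "point ?out s \<in> V (idx ?m)"
      using l(3) Scale by (simp add: mult.commute)
    then have "point ?out s \<in> V (idx (Ctl c))"
      using V_transition[OF t, of ?m "[coord_poly d 0 (clock_out b)]" "Ctl c"] Scale
      by (simp add: set_of_Cons eval_coord_poly)
    then show ?thesis
      by (rule V_Ctl_clock[OF locs]) (simp add: clock_out_def)
  next
    case (Is_one r)
    then have "r < R" using transition_regs[OF t] by simp
    then show ?thesis
      using V_transition[OF t, of "Ctl c0" "[coord_poly d (Suc r) 1]" "Ctl c"] IH l Is_one
      by (simp add: set_of_Cons eval_coord_poly)
  next
    case (Not_one r)
    then have "r < R" using transition_regs[OF t] by simp
    then have "point (1 / (s0 r - 1)) s0 \<in> V (idx (Ctl c))"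
      using V_transition[OF t, of "Ctl c0" "[not_one_poly d r]" "Ctl c"] IH l Not_one
      by (simp add: set_of_Cons eval_not_one_poly)
    then have "point (1 / (s0 r - 1)) s \<in> V (idx (Ctl c))" using l(3) Not_one by simp
    then show ?thesis
      by (rule V_Ctl_clock[OF locs]) (use l(2) Not_one in simp)
  qed
qed

lemma V_Blow_eq: "i < d \<Longrightarrow> j < d \<Longrightarrow> x \<in> V (idx (Blow i)) \<Longrightarrow> x \<in> V (idx (Blow j))"
proof -
  assume ij: "i < d" "j < d" and x: "x \<in> V (idx (Blow i))"
  then have "(Blow i, [], Blow j) \<in> set loc_edges" by (simp add: blow_edges)
  moreover have "x \<in> carrier_vec d"
    using x V_algebraic in_locations(2)[OF ij(1)] algebraic_set_subset_carrier by blast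
  ultimately show ?thesis using V_edge x by auto
qed

text \<open>Move to \<open>Blow i\<close>, rescale coordinate \<open>i\<close> from its nonzero
  value to the wanted one, and move back.\<close>

lemma V_Blow_coord:
  assumes x: "x \<in> V 1" "i < d" "i \<noteq> 3" "x $ i \<noteq> 0"
    and z: "z \<in> carrier_vec d" "\<And>k. k < d \<Longrightarrow> k \<noteq> i \<Longrightarrow> z $ k = x $ k"
  shows "z \<in> V 1"
proof -
  have "x \<in> V (idx (Blow i))" using x V_Blow_eq[of 0 i] by (simp add: idx_Blow_0)
  then have "scale d (flow_coords (Blow i)) (z $ i / x $ i) x \<in> V (idx (Blow i))"
    using V_scale in_locations(2) x by blast
  moreover have "scale d (flow_coords (Blow i)) (z $ i / x $ i) x = z"
    using x z by (intro eq_vecI) (auto simp: scale_def)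
  ultimately show ?thesis using V_Blow_eq[of i 0] x by (simp add: idx_Blow_0)
qed

lemma V_Blow_coords:
  assumes "finite J" "J \<subseteq> {..<d} - {3}" "x \<in> V 1" "\<And>i. i < d \<Longrightarrow> x $ i \<noteq> 0"
  shows "z \<in> carrier_vec d \<Longrightarrow> (\<And>k. k < d \<Longrightarrow> k \<notin> J \<Longrightarrow> z $ k = x $ k) \<Longrightarrow> z \<in> V 1"
  using assms(1,2)
proof (induction J arbitrary: z rule: finite_induct)
  case empty
  have "x \<in> carrier_vec d"
    using assms(3) V_algebraic[OF in_locations(2)[of 0]] algebraic_set_subset_carrier
    by (auto simp: idx_Blow_0)
  then have "z = x" using empty by (intro eq_vecI) auto
  then show ?case using assms(3) by simp
next
  case (insert j J)
  \<comment> \<open>Undoing the change at \<open>j\<close> gives a point covered by the induction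
    hypothesis; its entry at \<open>j\<close> is that of \<open>x\<close>, hence nonzero and ready
    to be rescaled.\<close>
  define z' where "z' = vec d (\<lambda>k. if k = j then x $ k else z $ k)"
  have "z' \<in> V 1"
    using insert.prems by (intro insert.IH) (auto simp: z'_def)
  moreover have "z' $ j = x $ j" using insert.prems by (auto simp: z'_def)
  ultimately show ?case
    using insert.prems assms(4) by (intro V_Blow_coord[of z' j z]) (auto simp: z'_def)
qed

text \<open>The line through \<open>z\<close> parallel to axis 3 meets the invariant at every height
  \<open>2 ^ n\<close>, the other coordinates being free, and therefore lies in it.\<close>

lemma V_Blow_all:
  assumes unbounded: "\<And>n. \<exists>c s. reachable e c s \<and> s 2 = 2 ^ n"
  shows "carrier_vec d \<subseteq> V 1"
proof
  fix z :: "real vec" assume z: "z \<in> carrier_vec d"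
  let ?L = "\<lambda>i. if i = 3 then [:0, 1:] else [:z $ i:]"
  have curve: "vec d (\<lambda>i. poly (?L i) t) $ 3 = t"
    "\<And>k. k < d \<Longrightarrow> k \<noteq> 3 \<Longrightarrow> vec d (\<lambda>i. poly (?L i) t) $ k = z $ k" for t
    using R by auto
  have "vec d (\<lambda>i. poly (?L i) (2 ^ n)) \<in> V 1" for n
  proof -
    obtain c s where c: "reachable e c s" "s 2 = 2 ^ n" using unbounded by blast
    have pos: "s r > 0" for r using steps_pos[OF c(1)] by (simp add: repr_def)
    have "(Ctl c, [], Blow 0) \<in> set loc_edges"
      using steps_residuals[OF c(1)] by (simp add: blow_edges)
    then have point: "point 1 s \<in> V 1"
      using V_edge[of "Ctl c" "[]" "Blow 0"] V_reachable[OF c(1)] by (simp add: idx_Blow_0)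
    have nonzero: "point 1 s $ i \<noteq> 0" if "i < d" for i
    proof (cases i)
      case (Suc r)
      then show ?thesis using that pos[of r] by simp
    qed simp
    have "point 1 s $ 3 = 2 ^ n"
      using point_sel(3)[of 2 1 s] R c(2) by (simp add: numeral_3_eq_3)
    then have rest: "vec d (\<lambda>i. poly (?L i) (2 ^ n)) $ k = point 1 s $ k"
      if "k < d" "k \<notin> {..<d} - {3}" for k
      using that curve(1)[of "2 ^ n"] by auto
    show ?thesis
      by (rule V_Blow_coords[where J = "{..<d} - {3}", OF _ _ point nonzero _ rest]) auto
  qed
  then have range: "vec d (\<lambda>i. poly (?L i) t) \<in> V 1" if "t \<in> range (\<lambda>n. 2 ^ n)" for t
    using that by blast
  have inf: "infinite (range (\<lambda>n. 2 ^ n :: real))"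
    by (rule range_inj_infinite) (auto simp: inj_def)
  have alg: "algebraic_set d (V 1)"
    using V_algebraic[OF in_locations(2)[of 0]] by (simp add: idx_Blow_0)
  have "vec d (\<lambda>i. poly (?L i) (z $ 3)) \<in> V 1"
    using algebraic_set_curve[OF alg inf range] by blast
  moreover have "vec d (\<lambda>i. poly (?L i) (z $ 3)) = z"
    using z by (intro eq_vecI) auto
  ultimately show "z \<in> V 1" by simp
qed

end


section \<open>A small invariant for a halting program\<close>

text \<open>At \<open>Mid\<close> the clock and the register keep the ratio they had on entry, which
  is one linear equation. \<open>Mid r b c'\<close> does not record where it was entered from, hence
  the union over all sources. At \<open>Blow\<close> only register 2 is remembered.\<close>

definition halting_invariant :: "nat \<Rightarrow> loc \<Rightarrow> real vec set" where
  "halting_invariant e l = (case l of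
     Ctl c \<Rightarrow> (\<Union>s\<in>{s. reachable e c s}. {x \<in> carrier_vec d. \<forall>r\<in>{..<R}. x $ Suc r - s r = 0})
   | Mid r b c' \<Rightarrow> (\<Union>s\<in>{s. \<exists>c. reachable e c s \<and> (Scale r b, c') \<in> set (succs c)}.
       {x \<in> carrier_vec d. \<forall>i\<in>{..<R}.
          real (clock_in b) * x $ Suc i - (if i = r then s i * x $ 0 else real (clock_in b) * s i) = 0})
   | Blow j \<Rightarrow> (\<Union>s\<in>{s. \<exists>c. reachable e c s}. {x \<in> carrier_vec d. x $ 3 - s 2 = 0}))"

lemma halting_invariant_algebraic:
  assumes fin: "finite {z. steps (prog, repr (input e)) z}"
  shows "algebraic_set d (halting_invariant e l)"
proof -
  have sub: "{s. \<exists>c. reachable e c s \<and> P c s} \<subseteq> snd ` {z. steps (prog, repr (input e)) z}" for P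
    by force
  have fin': "finite {s. \<exists>c. reachable e c s \<and> P c s}" for P
    using finite_subset[OF sub] fin by blast
  have fin_c: "finite {s. reachable e c s}" for c
    using fin'[of "\<lambda>c' s. c' = c"] by simp
  have fin_all: "finite {s. \<exists>c. reachable e c s}"
    using fin'[of "\<lambda>c s. True"] by simp
  show ?thesis
  proof (cases l)
    case (Ctl c)
    then show ?thesis
      unfolding halting_invariant_def using fin_c
      by (auto intro!: algebraic_set_UN algebraic_set_Ball polynomial_function_diff polynomial_function_intros
          simp del: right_minus_eq)
  next
    case (Mid r b c')
    let ?F = "\<lambda>s i x. real (clock_in b) * x $ Suc i -
      (if i = r then s i * x $ 0 else real (clock_in b) * s i)"
    have "polynomial_function d (?F s i)" if "i < R" for i and s :: "nat \<Rightarrow> real"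
      using that by (cases "i = r")
        (auto intro!: polynomial_function_diff polynomial_function_intros)
    then have "algebraic_set d {x \<in> carrier_vec d. \<forall>i\<in>{..<R}. ?F s i x = 0}" for s :: "nat \<Rightarrow> real"
      by (intro algebraic_set_Ball) (simp_all del: right_minus_eq)
    then show ?thesis
      unfolding halting_invariant_def Mid loc.case by (rule algebraic_set_UN[OF fin'])
  next
    case (Blow j)
    then show ?thesis
      unfolding halting_invariant_def using fin_all R
      by (auto intro!: algebraic_set_UN algebraic_set_zeros polynomial_function_diff polynomial_function_intros
          simp del: right_minus_eq)
  qed
qed

text \<open>At \<open>Mid\<close> both sides of the equation for \<open>r\<close> are multiplied by
  \<open>u\<close>; all other defining equations mention only coordinates that stand still.\<close>

lemma halting_invariant_scale:
  assumes "x \<in> halting_invariant e l"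
  shows "scale d (flow_coords l) u x \<in> halting_invariant e l"
proof (cases l)
  case (Mid r b c)
  with assms obtain s c0 where s: "reachable e c0 s" "(Scale r b, c) \<in> set (succs c0)"
    and x: "x \<in> carrier_vec d"
      "\<And>i. i < R \<Longrightarrow> real (clock_in b) * x $ Suc i = (if i = r then s i * x $ 0 else real (clock_in b) * s i)"
    by (auto simp: halting_invariant_def)
  have "real (clock_in b) * scale d (flow_coords l) u x $ Suc i -
      (if i = r then s i * scale d (flow_coords l) u x $ 0 else real (clock_in b) * s i) = 0"
    if "i < R" for i
    using that x(2)[OF that] by (auto simp: scale_def Mid)
  then show ?thesis
    using s unfolding Mid by (auto simp: halting_invariant_def scale_def)
qed (use assms R in \<open>auto simp: halting_invariant_def scale_def\<close>)

text \<open>The guards are exact. A clock at \<open>clock_out\<close> pins the register to the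
  doubled or halved value, and a solution of the disequality guard excludes the value 1, so nothing
  but genuine program steps gets through.\<close>

lemma halting_invariant_edge:
  assumes "(a, G, b) \<in> set loc_edges" "x \<in> halting_invariant e a" "x \<in> set_of d G"
  shows "x \<in> halting_invariant e b"
  using assms(1)
proof (cases rule: in_loc_edges)
  case (Enter c r k c')
  then show ?thesis
    using assms(2,3)
    by (force simp: halting_invariant_def set_of_Cons eval_coord_poly in_transitions)
next
  case (Leave c r k c')
  then obtain s c0 where s: "reachable e c0 s" "(Scale r k, c') \<in> set (succs c0)"
    and x: "x \<in> carrier_vec d"
      "\<And>i. i < R \<Longrightarrow> real (clock_in k) * x $ Suc i = (if i = r then s i * x $ 0 else real (clock_in k) * s i)"
    using assms(2) by (auto simp: halting_invariant_def)
  have y: "x $ 0 = real (clock_out k)"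
    using assms(3) Leave by (simp add: set_of_Cons eval_coord_poly)
  have "reachable e c' (effect (Scale r k) s)"
    using s step.intros[of "Scale r k" c' c0 s] by (auto intro: rtranclp.rtrancl_into_rtrancl)
  moreover have "x $ Suc i = effect (Scale r k) s i" if "i < R" for i
    using x(2)[OF that] y by (auto simp: clock_in_def field_simps split: if_splits)
  ultimately show ?thesis
    using x(1) Leave by (auto simp: halting_invariant_def)
next
  case (Tau c c')
  then obtain s where s: "reachable e c s" "\<forall>r<R. x $ Suc r = s r" "x \<in> carrier_vec d"
    using assms(2) by (auto simp: halting_invariant_def)
  have "step (c, s) (c', s)"
    using step.intros[of Tau c' c s] Tau by (simp add: in_transitions)
  then have "reachable e c' s" using s(1) by (auto intro: rtranclp.rtrancl_into_rtrancl)
  then show ?thesis using s Tau by (auto simp: halting_invariant_def)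
next
  case (Is_one c r c')
  then obtain s where s: "reachable e c s" "\<forall>r<R. x $ Suc r = s r" "x \<in> carrier_vec d"
    using assms(2) by (auto simp: halting_invariant_def)
  have "r < R" using transition_regs Is_one by force
  then have "step (c, s) (c', s)"
    using step.intros[of "Is_one r" c' c s] Is_one s assms(3)
    by (simp add: in_transitions set_of_Cons eval_coord_poly)
  then have "reachable e c' s" using s(1) by (auto intro: rtranclp.rtrancl_into_rtrancl)
  then show ?thesis using s Is_one by (auto simp: halting_invariant_def)
next
  case (Not_one c r c')
  then obtain s where s: "reachable e c s" "\<forall>r<R. x $ Suc r = s r" "x \<in> carrier_vec d"
    using assms(2) by (auto simp: halting_invariant_def)
  have r: "r < R" using transition_regs Not_one by force
  then have "x $ 0 * (s r - 1) = 1"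
    using Not_one s assms(3) by (simp add: set_of_Cons eval_not_one_poly)
  then have "s r \<noteq> 1" by auto
  then have "step (c, s) (c', s)"
    using step.intros[of "Not_one r" c' c s] Not_one by (simp add: in_transitions)
  then have "reachable e c' s" using s(1) by (auto intro: rtranclp.rtrancl_into_rtrancl)
  then show ?thesis using s Not_one by (auto simp: halting_invariant_def)
next
  case (Forget c j)
  then obtain s where s: "reachable e c s" "\<forall>r<R. x $ Suc r = s r" "x \<in> carrier_vec d"
    using assms(2) by (auto simp: halting_invariant_def)
  then have "x $ 3 = s 2" using R by (simp add: numeral_3_eq_3 numeral_2_eq_2)
  then show ?thesis using s Forget by (auto simp: halting_invariant_def)
next
  case (Blow i j)
  then show ?thesis using assms(2) by (simp add: halting_invariant_def)
qed

lemma halting_invariant_start: "start_point_set e \<subseteq> halting_invariant e (Ctl prog)"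
proof
  fix x assume x: "x \<in> start_point_set e"
  have "x $ Suc r = repr (input e) r" if "r < R" for r
  proof (cases r)
    case (Suc r')
    then have "Suc r \<in> {2..<d}" using that by simp
    then show ?thesis using x Suc unfolding start_point_set_def by (simp add: repr_def input_def)
  qed (use x in \<open>simp add: start_point_set_def repr_def input_def\<close>)
  then show "x \<in> halting_invariant e (Ctl prog)"
    using x by (auto simp: halting_invariant_def start_point_set_def)
qed

lemma halting_invariant:
  assumes "finite {z. steps (prog, repr (input e)) z}"
  shows "algebraic_inductive_invariant (system e) (\<lambda>q. halting_invariant e (locations ! q))"
  unfolding invariant_iff
proof (intro conjI allI impI ballI)
  show "start_point_set e \<subseteq> halting_invariant e (locations ! 0)"
    using halting_invariant_start by (simp add: locations_def)
next
  fix q t x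
  assume x: "x \<in> halting_invariant e (locations ! q)"
  then have "x \<in> carrier_vec d"
    using halting_invariant_algebraic[OF assms] algebraic_set_subset_carrier by blast
  then show "mat_exp (t \<cdot>\<^sub>m scaling_mat d (flow_coords (locations ! q))) *\<^sub>v x
      \<in> halting_invariant e (locations ! q)"
    using halting_invariant_scale[OF x] by (simp add: mat_exp_scaling_mat)
next
  fix z assume z: "z \<in> set loc_edges"
  obtain a G b where z': "z = (a, G, b)" by (cases z)
  have "locations ! idx a = a" "locations ! idx b = b"
    using loc_edges_locations idx z z' by blast+
  then show "case z of (a, G, b) \<Rightarrow>
      halting_invariant e (locations ! idx a) \<inter> set_of d G \<subseteq> halting_invariant e (locations ! idx b)"
    using halting_invariant_edge z z' by auto
qed (rule halting_invariant_algebraic[OF assms])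

text \<open>Register 2 takes finitely many values; a real number that is none of them gives a point
  outside.\<close>

lemma halting_invariant_Blow:
  assumes fin: "finite {z. steps (prog, repr (input e)) z}"
  shows "\<not> carrier_vec d \<subseteq> halting_invariant e (Blow 0)"
proof
  assume sub: "carrier_vec d \<subseteq> halting_invariant e (Blow 0)"
  have "finite ((\<lambda>z. snd z 2) ` {z. steps (prog, repr (input e)) z})" using fin by simp
  then obtain a :: real where a: "a \<notin> (\<lambda>z. snd z 2) ` {z. steps (prog, repr (input e)) z}"
    using ex_new_if_finite[OF infinite_UNIV_char_0] by blast
  have "vec d (\<lambda>i. a) \<in> halting_invariant e (Blow 0)" using sub by auto
  then obtain c s where "reachable e c s" "a = s 2"
    using R by (auto simp: halting_invariant_def)
  then show False using a by force
qed

text \<open>Location \<open>1\<close> is \<open>Blow 0\<close>.\<close>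

theorem strongest_invariant_halting:
  assumes "run prog (repr (input e)) s"
  shows "\<not> carrier_vec d \<subseteq> strongest_invariant (system e) 1"
proof -
  have fin: "finite {z. steps (prog, repr (input e)) z}"
    using finite_reachable[OF assms] .
  have "locations ! 1 = Blow 0" by (simp add: locations_def)
  then have "strongest_invariant (system e) 1 \<subseteq> halting_invariant e (Blow 0)"
    unfolding strongest_invariant_def using halting_invariant[OF fin] by fastforce
  then show ?thesis using halting_invariant_Blow[OF fin] by blast
qed

theorem strongest_invariant_unbounded:
  assumes "\<And>n. \<exists>c s. reachable e c s \<and> s 2 = 2 ^ n"
  shows "carrier_vec d \<subseteq> strongest_invariant (system e) 1"
  unfolding strongest_invariant_def using V_Blow_all assms by blast

end

section \<open>Codes of the whole space\<close>

primrec digits_value :: "nat \<Rightarrow> nat list \<Rightarrow> nat" where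
  "digits_value B [] = 0"
| "digits_value B (a # as) = a + B * digits_value B as"

lemma digits_value_inj:
  "length as = length bs \<Longrightarrow> set as \<subseteq> {..<B} \<Longrightarrow> set bs \<subseteq> {..<B} \<Longrightarrow>
    digits_value B as = digits_value B bs \<Longrightarrow> as = bs"
proof (induction as bs rule: list_induct2)
  case (Cons a as b bs)
  have "(a + B * digits_value B as) mod B = a" "(b + B * digits_value B bs) mod B = b"
    using Cons.prems(1,2) by auto
  then have "a = b" using Cons.prems(3) by (metis digits_value.simps(2))
  moreover from this have "digits_value B as = digits_value B bs"
    using Cons.prems by auto
  ultimately show ?case using Cons by simp
qed simp

lemma prod_power_digits:
  fixes t :: real
  shows "(\<Prod>i<length es. (t ^ (B ^ i)) ^ (es ! i)) = t ^ digits_value B es"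
proof (induction es arbitrary: t)
  case (Cons a es)
  have "(\<Prod>i<length (a # es). (t ^ (B ^ i)) ^ ((a # es) ! i)) =
      t ^ a * (\<Prod>i<length es. ((t ^ B) ^ (B ^ i)) ^ (es ! i))"
    by (simp add: prod.lessThan_Suc_shift power_mult del: prod.lessThan_Suc)
  then show ?case using Cons.IH[of "t ^ B"] by (simp add: power_add power_mult)
qed simp

lemma coeff_sum_monom:
  assumes "k \<notin> set (map snd ts)"
  shows "coeff (\<Sum>(a, n)\<leftarrow>ts. monom a n) k = 0"
  using assms by (induction ts) auto

text \<open>The Kronecker substitution \<open>x\<^sub>i = t ^ (B ^ i)\<close> separates the monomials.\<close>

lemma valid_mpoly_vanishes:
  assumes valid: "valid_mpoly d ts"
    and zero: "\<And>x. x \<in> carrier_vec d \<Longrightarrow> mpoly_eval (mpoly_of ts) x = 0"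
  shows "ts = []"
proof (cases ts)
  case (Cons t ts')
  obtain c es where t: "t = (c, es)" by (cases t)
  \<comment> \<open>Larger than every exponent in \<open>ts\<close>, so that exponent vectors are
    digit sequences in base \<open>B\<close>.\<close>
  define B where "B = Suc (\<Sum>(c, es)\<leftarrow>ts. sum_list es)"
  have len: "length es' = d" if "(c', es') \<in> set ts" for c' es'
    using valid that by (auto simp: valid_mpoly_def)
  have less: "set es' \<subseteq> {..<B}" if "(c', es') \<in> set ts" for c' es'
  proof
    fix a assume "a \<in> set es'"
    then have "a \<le> sum_list es'" by (rule member_le_sum_list) auto
    also have "\<dots> \<le> (\<Sum>(c, es)\<leftarrow>ts. sum_list es)"
      using that by (intro member_le_sum_list) force+
    finally show "a \<in> {..<B}" by (simp add: B_def)
  qed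
  let ?P = "\<lambda>ts. \<Sum>(a, n)\<leftarrow>map (\<lambda>(c, es). (alg_val c, digits_value B es)) ts. monom a n"
  have "poly (?P ts) t = 0" for t
  proof -
    let ?x = "vec d (\<lambda>i. t ^ (B ^ i))"
    have "mpoly_eval (mpoly_of ts) ?x = (\<Sum>(c, es)\<leftarrow>ts. alg_val c * (\<Prod>i<d. (?x $ i) ^ (es ! i)))"
      using len by (intro mpoly_eval_mpoly_of) auto
    also have "\<dots> = (\<Sum>(c, es)\<leftarrow>ts. alg_val c * t ^ digits_value B es)"
    proof (intro arg_cong[where f = sum_list] map_cong refl, clarify)
      fix c es assume "(c, es) \<in> set ts"
      then have "length es = d" by (rule len)
      then show "alg_val c * (\<Prod>i<d. (?x $ i) ^ (es ! i)) = alg_val c * t ^ digits_value B es"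
        using prod_power_digits[of t B es] by simp
    qed
    also have "\<dots> = poly (?P ts) t"
      by (induction ts) (auto simp: poly_monom)
    finally show ?thesis using zero by simp
  qed
  then have "?P ts = 0" using poly_all_0_iff_0 by blast
  \<comment> \<open>The first monomial shares its power of \<open>t\<close> with no other one, so
    the coefficient there is \<open>alg_val c\<close>.\<close>
  moreover have "digits_value B es \<notin> snd ` (\<lambda>(c, es). (alg_val c, digits_value B es)) ` set ts'"
  proof
    assume "digits_value B es \<in> snd ` (\<lambda>(c, es). (alg_val c, digits_value B es)) ` set ts'"
    then obtain c' es' where "(c', es') \<in> set ts'" "digits_value B es = digits_value B es'" by auto
    moreover have "(c, es) \<in> set ts" "(c', es') \<in> set ts"
      using \<open>(c', es') \<in> set ts'\<close> by (simp_all add: Cons t)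
    ultimately have "es = es'"
      using digits_value_inj[of es es' B] len less by metis
    then show False using \<open>(c', es') \<in> set ts'\<close> valid
      unfolding Cons t by (force simp: valid_mpoly_def)
  qed
  then have "coeff (?P ts') (digits_value B es) = 0"
    by (intro coeff_sum_monom) (simp only: set_map not_False_eq_True)
  ultimately have "alg_val c = 0"
    using coeff_add[of "monom (alg_val c) (digits_value B es)" "?P ts'" "digits_value B es"]
    unfolding Cons t by simp
  then show ?thesis using valid unfolding Cons t by (simp add: valid_mpoly_def)
qed

text \<open>The normal form of codes makes a semantic question syntactic: among valid polynomial
  codes only \<open>[]\<close> vanishes everywhere. The number \<open>k\<close> of such polynomials
  is arbitrary, which turns the test into a search.\<close>

lemma carrier_subset_set_of_iff:
  assumes "valid_set d ps"
  shows "carrier_vec d \<subseteq> set_of d ps \<longleftrightarrow> (\<exists>k. encode_set ps = list_encode (replicate k 0))"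
proof -
  have replicate: "encode_set (replicate k []) = list_encode (replicate k 0)" for k
    by (simp add: encode_set_def encode_list_def encode_mpoly_def)
  have "carrier_vec d \<subseteq> set_of d ps \<longleftrightarrow> (\<forall>p\<in>set ps. p = [])"
  proof
    assume sub: "carrier_vec d \<subseteq> set_of d ps"
    show "\<forall>p\<in>set ps. p = []"
    proof
      fix p assume "p \<in> set ps"
      then show "p = []"
        using assms sub by (intro valid_mpoly_vanishes[of d]) (auto simp: set_of_def zero_set_def valid_set_def)
    qed
  qed (auto simp: set_of_def zero_set_def)
  also have "\<dots> \<longleftrightarrow> (\<exists>k. ps = replicate k [])"
    using replicate_length_same[of ps "[]"] by (auto dest: sym)
  also have "\<dots> \<longleftrightarrow> (\<exists>k. encode_set ps = encode_set (replicate k []))"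
    by (simp add: inj_eq[OF inj_encode_set])
  finally show ?thesis by (simp add: replicate)
qed

section \<open>Self-reference\<close>

text \<open>The code of \<open>system_code e\<close> depends on \<open>e\<close> only at one place, and \<open>cs\<close> lists the codes of the parts
  around that place. Choosing for \<open>e\<close> the code of \<open>cs\<close> itself, a program that is started in this system can
  compute the code of the system from its input.\<close>

definition fill :: "nat list \<Rightarrow> nat \<Rightarrow> nat" where
  "fill cs e =
     prod_encode (cs ! 7, prod_encode (Suc (prod_encode (prod_encode (cs ! 4,
       Suc (prod_encode (Suc (prod_encode (prod_encode (cs ! 1,
         Suc (prod_encode (e, cs ! 0))), cs ! 2)), cs ! 3))), cs ! 5)), cs ! 6))"

text \<open>Seen as a tree of pairs and of list cells \<open>Suc (prod_encode ...)\<close>, the code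
  has a single path from the root to \<open>e\<close>; the eight entries are the subtrees that
  branch off this path.\<close>

lemma (in program) system_code_fill:
  "\<exists>cs. length cs = 8 \<and> (\<forall>e. encode_system (system_code e) = fill cs e)"
proof -
  let ?loc = "encode_pair (encode_list (encode_list encode_alg)) encode_set"
  let ?cs = "[list_encode (replicate R 0), encode_alg (num (- 1)),
    encode_mpoly [(num 1, square_free d {1})], encode_set start_rest,
    encode_list (encode_list encode_alg) (loc_rows (Ctl prog)),
    encode_list ?loc (map (\<lambda>l. (loc_rows l, [unit_poly d])) (tl locations)),
    encode_list (encode_pair id (encode_pair encode_set id)) (map (\<lambda>(a, G, b). (idx a, G, idx b)) loc_edges),
    d]"
  have "encode_system (system_code e) = fill ?cs e" for e
    by (simp add: fill_def system_code_def encode_system_def encode_pair_def encode_list_def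
        encode_set_def encode_mpoly_def power_poly_def)
  then show ?thesis by (intro exI[of _ ?cs]) simp
qed

definition "recf_cons f g = Comp Succ [Comp recf_pair [f, g]]"

definition "recf_fill =
  Comp recf_pair [recf_component 7, Comp recf_pair [recf_cons (Comp recf_pair [recf_component 4,
    recf_cons (recf_cons (Comp recf_pair [recf_component 1,
      recf_cons (Proj 0) (recf_component 0)]) (recf_component 2)) (recf_component 3)])
    (recf_component 5), recf_component 6]]"

text \<open>The diagonal step of a quine: the same number is read as the template, by its
  components, and inserted unread, by \<open>Proj 0\<close>.\<close>

lemma recf_fill:
  assumes "length cs = 8"
  shows "rec_eval recf_fill [tuple_encode cs] (fill cs (tuple_encode cs))"
proof -
  have comp: "rec_eval (recf_component i) [tuple_encode cs] (cs ! i)" if "i < 8" for i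
    using recf_component assms that by simp
  have cons: "rec_eval (recf_cons f g) xs (Suc (prod_encode (a, b)))"
    if "rec_eval f xs a" "rec_eval g xs b" for f g xs a b
    unfolding recf_cons_def by (rule rec_eval_basics recf_pair that)+
  have pair: "rec_eval (Comp recf_pair [f, g]) xs (prod_encode (a, b))"
    if "rec_eval f xs a" "rec_eval g xs b" for f g xs a b
    by (rule rec_eval_basics recf_pair that)+
  show ?thesis
    unfolding recf_fill_def fill_def by (intro pair cons comp rec_eval_Proj_0) simp_all
qed

text \<open>The program searches for the least \<open>k\<close> such that the list of \<open>k\<close> zeros has the code that \<open>f\<close> computes.
  Register \<open>2\<close> holds \<open>k\<close>.\<close>

definition search_loop :: com where
  "search_loop = While 3 (Seq (increment 2) (compile recf_zeros_dist [2, 1] 3 4))"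

text \<open>Register 0 is the input, 1 the code to be recognised, 2 the counter, 3 the distance that
  controls the loop; working space begins at 4.\<close>

definition search :: "recf \<Rightarrow> com" where
  "search f = Seq (compile f [0] 1 4) (Seq (clear 2)
     (Seq (compile recf_zeros_dist [2, 1] 3 4) search_loop))"

lemma steps_Seq_exec: "exec c \<sigma> \<sigma>' \<Longrightarrow> steps (Seq c d, repr \<sigma>) (d, repr \<sigma>')"
  unfolding exec_def by (rule steps_Seq_run)

definition zeros_dist :: "nat \<Rightarrow> nat \<Rightarrow> nat" where
  "zeros_dist v k = (list_encode (replicate k 0) - v) + (v - list_encode (replicate k 0))"

lemma exec_zeros_dist:
  assumes "\<sigma> 1 = v" "\<sigma> 2 = k"
  shows "\<exists>\<sigma>'. exec (compile recf_zeros_dist [2, 1] 3 4) \<sigma> \<sigma>' \<and>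
    \<sigma>' 1 = v \<and> \<sigma>' 2 = k \<and> \<sigma>' 3 = zeros_dist v k"
proof -
  have "map \<sigma> [2, 1] = [k, v]" "3 < (4::nat)" "set [2, 1] \<subseteq> {..<4} - {3::nat}"
    using assms by auto
  from evaluatesD[OF compile_correct[OF recf_zeros_dist] this] show ?thesis
    using assms by (auto simp: zeros_dist_def)
qed

text \<open>Serves both outcomes: the least zero of the distance as \<open>k\<close> gives a halting
  run, and if there is no zero, every \<open>k\<close> appears in register 2.\<close>

lemma search_steps:
  assumes v: "rec_eval f [\<sigma> 0] v"
  shows "\<forall>j<k. zeros_dist v j \<noteq> 0 \<Longrightarrow> \<exists>\<sigma>'. steps (search f, repr \<sigma>) (search_loop, repr \<sigma>') \<and>
    \<sigma>' 1 = v \<and> \<sigma>' 2 = k \<and> \<sigma>' 3 = zeros_dist v k"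
proof (induction k)
  case 0
  have "map \<sigma> [0] = [\<sigma> 0]" "1 < (4::nat)" "set [0] \<subseteq> {..<4} - {1::nat}" by auto
  from evaluatesD[OF compile_correct[OF v] this]
  obtain \<sigma>1 where 1: "exec (compile f [0] 1 4) \<sigma> \<sigma>1" "\<sigma>1 1 = v" by blast
  have "(\<sigma>1(2 := 0)) 1 = v" "(\<sigma>1(2 := 0)) 2 = 0" using 1 by auto
  from exec_zeros_dist[OF this] obtain \<sigma>2 where
    2: "exec (compile recf_zeros_dist [2, 1] 3 4) (\<sigma>1(2 := 0)) \<sigma>2"
      "\<sigma>2 1 = v" "\<sigma>2 2 = 0" "\<sigma>2 3 = zeros_dist v 0" by blast
  have "steps (search f, repr \<sigma>) (search_loop, repr \<sigma>2)"
    unfolding search_def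
    by (rule rtranclp_trans[OF steps_Seq_exec[OF 1(1)]
          rtranclp_trans[OF steps_Seq_exec[OF exec_clear] steps_Seq_exec[OF 2(1)]]])
  then show ?case using 2 by blast
next
  case (Suc k)
  then obtain \<sigma>1 where 1: "steps (search f, repr \<sigma>) (search_loop, repr \<sigma>1)"
    "\<sigma>1 1 = v" "\<sigma>1 2 = k" "\<sigma>1 3 = zeros_dist v k" by auto
  let ?\<sigma> = "\<sigma>1(2 := Suc (\<sigma>1 2))"
  have "?\<sigma> 1 = v" "?\<sigma> 2 = Suc k" using 1 by auto
  from exec_zeros_dist[OF this] obtain \<sigma>2 where
    2: "exec (compile recf_zeros_dist [2, 1] 3 4) ?\<sigma> \<sigma>2"
      "\<sigma>2 1 = v" "\<sigma>2 2 = Suc k" "\<sigma>2 3 = zeros_dist v (Suc k)" by blast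
  have "repr \<sigma>1 3 \<noteq> 1" using 1(4) Suc.prems by (simp add: repr_eq_1_iff)
  then have "steps (search_loop, repr \<sigma>1) (search_loop, repr \<sigma>2)"
    unfolding search_loop_def
    by (rule steps_While) (use exec_Seq[OF exec_increment 2(1)] in \<open>simp add: exec_def\<close>)
  then show ?case using rtranclp_trans[OF 1(1)] 2 by blast
qed

lemma exists_register_bound:
  "\<exists>R>2. \<forall>c\<in>set (residuals prog). \<forall>l c'. (l, c') \<in> set (succs c) \<longrightarrow> act_regs l \<subseteq> {..<R}"
proof -
  let ?A = "\<Union>c\<in>set (residuals prog). \<Union>(l, c')\<in>set (succs c). act_regs l"
  have "finite (act_regs l)" for l by (cases l) auto
  then have "finite ?A" by auto
  then obtain m where "\<forall>r\<in>?A. r < m" using finite_nat_set_iff_bounded by blast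
  then show ?thesis by (intro exI[of _ "m + 3"]) fastforce
qed

theorem theorem13:
  shows "\<not> (\<exists>f :: recf. \<forall>(C :: system_code) (S :: switching_system).
           switching_system_eq_guards S \<and> represents_system C S \<longrightarrow>
           (\<exists>W :: set_code list.
              rec_eval f [encode_system C] (encode_family W) \<and>
              represents_family S W (strongest_invariant S)))"
proof
  assume "\<exists>f :: recf. \<forall>(C :: system_code) (S :: switching_system).
           switching_system_eq_guards S \<and> represents_system C S \<longrightarrow>
           (\<exists>W :: set_code list.
              rec_eval f [encode_system C] (encode_family W) \<and>
              represents_family S W (strongest_invariant S))"
  then obtain f where *: "\<And>C S. switching_system_eq_guards S \<and> represents_system C S \<longrightarrow>
      (\<exists>W. rec_eval f [encode_system C] (encode_family W) \<and>
        represents_family S W (strongest_invariant S))"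
    by blast
  have f: "\<exists>W. rec_eval f [encode_system C] (encode_family W) \<and>
      represents_family (system_of C) W (strongest_invariant (system_of C))" if "valid_system C" for C
    using *[of "system_of C" C] switching_system_eq_guards_system_of[OF that] that
    by (simp add: represents_system_def)
  let ?T = "Comp recf_second [Comp f [recf_fill]]"
  \<comment> \<open>The text of the program depends on \<open>f\<close> only. The parts
    \<open>cs\<close> are obtained from it afterwards and reach it as its input, so there is no
    circularity.\<close>
  define prog where "prog = search ?T"
  obtain R where R: "2 < R" "\<forall>c\<in>set (residuals prog). \<forall>l c'. (l, c') \<in> set (succs c) \<longrightarrow> act_regs l \<subseteq> {..<R}"
    using exists_register_bound by blast
  interpret program prog R
    by standard (use R in blast)+
  obtain cs where cs: "length cs = 8" "\<And>e. encode_system (system_code e) = fill cs e"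
    using system_code_fill by blast
  let ?e = "tuple_encode cs"
  obtain W where W: "rec_eval f [encode_system (system_code ?e)] (encode_family W)"
      "represents_family (system ?e) W (strongest_invariant (system ?e))"
    using f[OF valid_system_code] by blast
  have "{..<length W} = {..<length locations}"
    using W(2) by (simp add: represents_family_def system_sel)
  then have "length W > 1" by (simp add: locations_def)
  then obtain w0 w1 ws where ws: "W = w0 # w1 # ws"
    by (metis One_nat_def length_Cons list.exhaust list.size(3) not_less_zero less_irrefl)
  have w1: "valid_set d w1" "strongest_invariant (system ?e) 1 = set_of d w1"
    using W(2) \<open>length W > 1\<close> by (auto simp: represents_family_def system_sel ws dest!: bspec[of _ _ 1])
  let ?v = "encode_set w1"
  have "rec_eval recf_second [encode_family W] ?v"
    using recf_second[of "encode_set w0" ?v "map encode_set ws"]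
    by (simp add: encode_family_def encode_list_def ws)
  \<comment> \<open>On its input \<open>?e\<close> the program obtains the code of the very system
    it runs in, and from it the code of the set at location 1.\<close>
  then have v: "rec_eval ?T [input ?e 0] ?v"
    using W(1) recf_fill[OF cs(1)] by (auto simp: cs(2) input_def intro: rec_eval_Comp1)
  have zeros: "zeros_dist ?v k = 0 \<longleftrightarrow> ?v = list_encode (replicate k 0)" for k
    by (auto simp: zeros_dist_def)
  show False
  proof (cases "\<exists>k. zeros_dist ?v k = 0")
    case True
    then obtain k where k: "zeros_dist ?v k = 0" "\<forall>j<k. zeros_dist ?v j \<noteq> 0"
      using exists_least_iff[of "\<lambda>k. zeros_dist ?v k = 0"] by auto
    obtain \<sigma> where \<sigma>: "steps (prog, repr (input ?e)) (search_loop, repr \<sigma>)" "\<sigma> 3 = 0"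
      using search_steps[where \<sigma> = "input ?e", OF v k(2)] k(1) unfolding prog_def by auto
    have "run search_loop (repr \<sigma>) (repr \<sigma>)"
      unfolding search_loop_def using \<sigma>(2) by (intro run_While_one) (simp add: repr_eq_1_iff)
    then have "run prog (repr (input ?e)) (repr \<sigma>)"
      unfolding run_def by (rule rtranclp_trans[OF \<sigma>(1)])
    \<comment> \<open>The program has halted because \<open>w1\<close> describes the whole space,
      but halting makes the set at location 1 smaller.\<close>
    from strongest_invariant_halting[OF this] show False
      using True w1 by (simp add: zeros carrier_subset_set_of_iff)
  next
    case False
    \<comment> \<open>No test succeeds, so the counter passes every \<open>n\<close>; this makes the
      set at location 1 the whole space, which \<open>w1\<close> does not describe.\<close>
    have "\<exists>c s. reachable ?e c s \<and> s 2 = 2 ^ n" for n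
    proof -
      obtain \<sigma> where "reachable ?e search_loop (repr \<sigma>)" "\<sigma> 2 = n"
        using search_steps[where \<sigma> = "input ?e" and k = n, OF v] False unfolding prog_def by auto
      then show ?thesis by (auto simp: repr_def intro!: exI[of _ search_loop] exI[of _ "repr \<sigma>"])
    qed
    from strongest_invariant_unbounded[OF this] show False
      using False w1 by (simp add: zeros carrier_subset_set_of_iff)
  qed
qed

end
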